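(* Let $a,b$ be natural numbers with $2\le a<b$ and $\gcd(a,b)=1$. Then for every real $x>1$, \[ \begin{aligned} N^{(2)}_{a,b}(x)&=\frac{\pi\log(x)}{4\sqrt{\log(a)\log(b)}}+\frac{1}{2}\sqrt{\frac{\log(x)}{\log(a)}}+\frac{1}{2}\sqrt{\frac{\log(x)}{\log(b)}}+\frac{1}{4}-\frac{1}{2}B^{*}_{1}\left(\left\{\sqrt{\frac{\log(x)}{\log(a)}}\right\}\right)-\frac{1}{2}B^{*}_{1}\left(\left\{\sqrt{\frac{\log(x)}{\log(b)}}\right\}\right)\\ &\quad+\sqrt{\log(x)}\sum_{n=1}^{\infty}\sum_{m=1}^{\infty}\frac{J_{1}\left(2\pi\sqrt{\frac{n^{2}\log(a)+m^{2}\log(b)}{\log(a)\log(b)}\log(x)}\right)}{\sqrt{n^{2}\log(a)+m^{2}\log(b)}}\\ &\quad+\frac{1}{2}\sqrt{\frac{\log(x)}{\log(a)}}\sum_{k=1}^{\infty}\frac{J_{1}\left(2\pi k\sqrt{\frac{\log(x)}{\log(b)}}\right)}{k}+\frac{1}{2}\sqrt{\frac{\log(x)}{\log(b)}}\sum_{k=1}^{\infty}\frac{J_{1}\left(2\pi k\sqrt{\frac{\log(x)}{\log(a)}}\right)}{k}+\frac{1}{2}\chi_{S^{(2)}_{a,b}}(x). \end{aligned} \]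
   Context: $\log$ is the natural logarithm, $\mathbb{N}_0=\{0,1,2,\dots\}$, and $J_1$ is the Bessel function of the first kind of order $1$. $N^{(2)}_{a,b}(x)$ is the number of pairs $(p,q)\in\mathbb{N}_0^2$ with $a^{p^2}b^{q^2}\le x$; $S^{(2)}_{a,b}=\{a^{p^2}b^{q^2}:p,q\in\mathbb{N}_0\}$ and $\chi_{S^{(2)}_{a,b}}(x)$ is $1$ if $x\in S^{(2)}_{a,b}$ and $0$ otherwise. $\{y\}$ is the fractional part; $B^*_1(\{y\})=\{y\}-\tfrac12$ if $y\notin\mathbb{Z}$ and $0$ if $y\in\mathbb{Z}$.
   Formalization: The double series over n and m is taken as the limit of square partial sums (n, m ≤ K, K → ∞); summing over m first and then over n would make the formula false when x = a^(p^2) with p ≥ 1 (for a=2, b=3, x=2 it gives 7/4 instead of 2). *)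

theory Defs
  imports "HOL-Analysis.Analysis"
begin

definition bessel_J :: "nat \<Rightarrow> real \<Rightarrow> real" where
  "bessel_J \<nu> z = (\<Sum>k. (-1) ^ k / (fact k * fact (k + \<nu>)) * (z / 2) ^ (2 * k + \<nu>))"

definition N2 :: "nat \<Rightarrow> nat \<Rightarrow> real \<Rightarrow> nat" where
  "N2 a b x = card {(p :: nat, q :: nat). real (a ^ (p\<^sup>2) * b ^ (q\<^sup>2)) \<le> x}"

definition S2 :: "nat \<Rightarrow> nat \<Rightarrow> real set" where
  "S2 a b = {real (a ^ (p\<^sup>2) * b ^ (q\<^sup>2)) | p q :: nat. True}"

text \<open>The normalised sawtooth; it is meant to be applied to a fractional part.\<close>

definition B1_star :: "real \<Rightarrow> real" where
  "B1_star t = (if t \<in> \<int> then 0 else t - 1 / 2)"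

lemma B1_star_frac: "B1_star (frac y) = (if y \<in> \<int> then 0 else frac y - 1 / 2)"
proof -
  have "frac y \<in> \<int> \<longleftrightarrow> y \<in> \<int>"
    by (metis Ints_0 Ints_add Ints_of_int frac_def diff_add_cancel frac_eq_0_iff)
  then show ?thesis
    by (simp add: B1_star_def)
qed

text \<open>
  The value of a double series, as the limit of its square partial sums. For the conditionally
  convergent Bessel double series considered here the mode of summation matters: summing over
  \<open>m\<close> to infinity first and over \<open>n\<close> afterwards gives a value that is smaller by
  \<open>1 / (4 * sqrt (ln x))\<close> when \<open>x = a ^ (p\<^sup>2)\<close> with \<open>p \<ge> 1\<close> (the corresponding lattice point lies
  where the tangent of the ellipse is parallel to a coordinate axis), and the opposite order
  has the same defect at \<open>x = b ^ (q\<^sup>2)\<close>. The square partial sums treat both indices alike.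
\<close>

definition double_sums :: "(nat \<Rightarrow> nat \<Rightarrow> real) \<Rightarrow> real \<Rightarrow> bool" (infixr "double'_sums" 80) where
  "f double_sums s \<longleftrightarrow> (\<lambda>K. \<Sum>n<K. \<Sum>m<K. f n m) \<longlonglongrightarrow> s"

end

theory Submission
  imports Defs
begin

text \<open>
  Put \<open>A = sqrt (ln x / ln a)\<close> and \<open>B = sqrt (ln x / ln b)\<close>, so that \<open>N2\<close> counts lattice points
  in a quarter of the ellipse \<open>(p / A)\<^sup>2 + (q / B)\<^sup>2 \<le> 1\<close>. The square partial sums of the
  Fourier series of its indicator are the integrals of \<open>D\<^sub>K(u) D\<^sub>K(v)\<close> over the ellipse, where
  \<open>D\<^sub>K\<close> is the Dirichlet kernel. Integrating in \<open>v\<close> and parametrising the arc by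
  \<open>u = A sin \<theta>\<close>, \<open>v = B cos \<theta>\<close> leaves the integral of \<open>A cos \<theta> D\<^sub>K(A sin \<theta>) R\<^sub>K(B cos \<theta>)\<close>,
  with \<open>R\<^sub>K\<close> the primitive of \<open>D\<^sub>K\<close>. On the one hand, expanding it and using the Poisson integrals
  for \<open>J\<^sub>1\<close> produces the Bessel sums. On the other hand \<open>R\<^sub>K\<close> tends to a staircase; replacing
  \<open>R\<^sub>K(B cos \<theta>)\<close> by that staircase produces exactly a finite sum of values of \<open>R\<^sub>K\<close>, whose limits
  count the lattice points, and the error tends to \<open>0\<close> by bounded convergence.

  Coprimality of \<open>a\<close> and \<open>b\<close> means that at most one lattice point lies on the arc, so \<open>A\<close> and \<open>B\<close>
  are not both integers. The error analysis needs \<open>B \<notin> \<int>\<close> (at a lattice point \<open>(0, B)\<close> the error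
  would not vanish), and the case \<open>B \<in> \<int>\<close> follows by exchanging the axes.
\<close>

subsection \<open>The Dirichlet kernel and its primitive\<close>

text \<open>The sum of \<open>exp (2 pi i m t)\<close> over |m| \<le> K in real form, scaled to
  period 1 so that its peaks sit exactly at the integers.\<close>

definition dirichlet :: "nat \<Rightarrow> real \<Rightarrow> real" where
  "dirichlet K t = 1 + 2 * (\<Sum>m<K. cos (2 * pi * real (Suc m) * t))"

text \<open>The primitive of \<open>dirichlet K\<close> that vanishes at 0. The sine sum is the
  partial Fourier series of the sawtooth \<open>1/2 - frac t\<close>, so the total approximates a
  staircase.\<close>

definition dirichlet_int :: "nat \<Rightarrow> real \<Rightarrow> real" where
  "dirichlet_int K t = t + (\<Sum>m<K. sin (2 * pi * real (Suc m) * t) / (pi * real (Suc m)))"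

text \<open>The value at an integer is the mean of the two one-sided limits of the staircase, which
  is the value that the Fourier series picks at a jump.\<close>

definition mid_floor :: "real \<Rightarrow> real" where
  "mid_floor t = (if t \<in> \<int> then t else of_int \<lfloor>t\<rfloor> + 1 / 2)"

lemma has_field_derivative_dirichlet_int [derivative_intros]:
  assumes "(f has_field_derivative f') (at x within S)"
  shows "((\<lambda>x. dirichlet_int K (f x)) has_field_derivative dirichlet K (f x) * f') (at x within S)"
proof -
  have *: "(dirichlet_int K has_field_derivative dirichlet K t) (at t)" for t
  proof -
    have "((\<lambda>t. sin (2 * pi * real (Suc m) * t) / (pi * real (Suc m)))
        has_real_derivative 2 * cos (2 * pi * real (Suc m) * t)) (at t)" for m
      using pi_gt_zero by (auto intro!: derivative_eq_intros simp: divide_simps)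
    then show ?thesis
      unfolding dirichlet_int_def dirichlet_def sum_distrib_left
      by (intro DERIV_add DERIV_ident DERIV_sum)
  qed
  show ?thesis
    by (rule DERIV_chain2[OF * assms])
qed

lemma continuous_on_dirichlet_int [continuous_intros]:
  "continuous_on S f \<Longrightarrow> continuous_on S (\<lambda>x. dirichlet_int K (f x))"
  by (rule continuous_on_compose2[OF _ _ subset_UNIV])
     (auto intro!: DERIV_continuous_on has_field_derivative_dirichlet_int[OF DERIV_ident])

lemma continuous_on_dirichlet [continuous_intros]:
  fixes f :: "'a::t2_space \<Rightarrow> real"
  shows "continuous_on S f \<Longrightarrow> continuous_on S (\<lambda>x. dirichlet K (f x))"
  unfolding dirichlet_def by (intro continuous_intros)

text \<open>Each new term adds \<open>2 cos c sin (pi t) = sin (c + pi t) - sin (c - pi t)\<close>,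
  so the sum telescopes. The form without division stays valid at integers \<open>t\<close>.\<close>

lemma dirichlet_mult_sin: "dirichlet K t * sin (pi * t) = sin ((2 * real K + 1) * pi * t)"
proof (induction K)
  case (Suc K)
  let ?c = "2 * pi * real (Suc K) * t"
  have "dirichlet (Suc K) t * sin (pi * t) = dirichlet K t * sin (pi * t) + 2 * cos ?c * sin (pi * t)"
    by (simp add: dirichlet_def algebra_simps)
  also have "\<dots> = sin (?c - pi * t) + 2 * cos ?c * sin (pi * t)"
    unfolding Suc by (simp add: algebra_simps)
  also have "\<dots> = sin (?c + pi * t)"
    unfolding sin_add sin_diff by simp
  finally show ?case
    by (simp add: algebra_simps)
qed (simp add: dirichlet_def)

lemma abs_dirichlet_mult_sin_le: "\<bar>dirichlet K t\<bar> * \<bar>sin (pi * t)\<bar> \<le> 1"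
  by (metis abs_mult dirichlet_mult_sin abs_sin_le_one)

lemma abs_dirichlet_le: "\<bar>dirichlet K t\<bar> \<le> 2 * real K + 1"
proof -
  have "\<bar>\<Sum>m<K. cos (2 * pi * real (Suc m) * t)\<bar> \<le> (\<Sum>m<K. 1)"
    by (intro order.trans[OF sum_abs] sum_mono) auto
  then show ?thesis
    by (auto simp: dirichlet_def)
qed

lemma dirichlet_minus [simp]: "dirichlet K (- t) = dirichlet K t"
  by (simp add: dirichlet_def)

lemma dirichlet_int_minus [simp]: "dirichlet_int K (- t) = - dirichlet_int K t"
  by (simp add: dirichlet_int_def sum_negf)

lemma dirichlet_int_0 [simp]: "dirichlet_int K 0 = 0"
  by (simp add: dirichlet_int_def)

lemma dirichlet_add_int [simp]: "dirichlet K (t + of_int n) = dirichlet K t"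
proof -
  have "cos (2 * pi * real (Suc m) * (t + of_int n)) = cos (2 * pi * real (Suc m) * t)" for m
  proof -
    have "2 * pi * real (Suc m) * (t + of_int n)
        = 2 * pi * real (Suc m) * t + 2 * pi * of_int (int (Suc m) * n)"
      by (simp add: algebra_simps)
    then show ?thesis
      by (simp only: cos_add cos_int_2pin sin_int_2pin)
  qed
  then show ?thesis
    by (simp add: dirichlet_def)
qed

lemma dirichlet_int_add_int [simp]: "dirichlet_int K (t + of_int n) = dirichlet_int K t + of_int n"
proof -
  have "sin (2 * pi * real (Suc m) * (t + of_int n)) = sin (2 * pi * real (Suc m) * t)" for m
  proof -
    have "2 * pi * real (Suc m) * (t + of_int n)
        = 2 * pi * real (Suc m) * t + 2 * pi * of_int (int (Suc m) * n)"
      by (simp add: algebra_simps)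
    then show ?thesis
      by (simp only: sin_add cos_int_2pin sin_int_2pin)
  qed
  then show ?thesis
    by (simp add: dirichlet_int_def)
qed

lemma dirichlet_int_of_int [simp]: "dirichlet_int K (of_int n) = of_int n"
  using dirichlet_int_add_int[of K 0 n] by simp

text \<open>Jordan's inequality: by concavity the sine lies above its chord from 0 to
  \<open>pi / 2\<close>.\<close>

lemma sin_pi_ge: "2 * t \<le> sin (pi * t)" if "0 \<le> t" "t \<le> 1 / 2"
proof -
  have "convex_on {0..pi} (\<lambda>x. - sin x)"
    by (rule f''_ge0_imp_convex[where f' = "\<lambda>x. - cos x" and f'' = sin])
       (auto intro!: derivative_eq_intros sin_ge_zero)
  from convex_onD[OF this, of "2 * t" 0 "pi / 2"] that show ?thesis
    by (simp add: mult.commute)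
qed

text \<open>Integration by parts of \<open>sin (M * pi * s) / sin (pi * s)\<close>: \<open>W\<close>
  is the primitive plus the boundary term, and the derivative of \<open>V\<close> dominates that of
  \<open>W\<close> in absolute value. Hence \<open>W + V\<close> decreases and \<open>W - V\<close>
  increases on \<open>{t..1/2}\<close>, which keeps \<open>W t\<close> within \<open>V t\<close> of
  \<open>W (1/2) = 1/2\<close>. The boundary term costs another \<open>V t\<close>, and pi > 2
  absorbs the factor 2.\<close>

lemma dirichlet_int_bound_half:
  assumes "0 < t" "t \<le> 1 / 2"
  shows "\<bar>dirichlet_int K t - 1 / 2\<bar> * sin (pi * t) \<le> 1 / (2 * real K + 1)"
proof -
  define M where "M = 2 * real K + 1"
  have M: "M > 0" "M * pi > 0" by (simp_all add: M_def)
  define W where "W s = dirichlet_int K s + cos (M * pi * s) / (M * pi * sin (pi * s))" for s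
  define V where "V s = 1 / (M * pi * sin (pi * s))" for s
  have sin_pos: "sin (pi * s) > 0" if "s \<in> {t..1/2}" for s
    using that assms by (intro sin_gt_zero) (auto simp: field_simps intro: le_less_trans[of _ "1/2"])
  have derivW: "(W has_real_derivative - (cos (M * pi * s) * cos (pi * s) / (M * (sin (pi * s))\<^sup>2))) (at s)"
    if "s \<in> {t..1/2}" for s
  proof -
    have *: "dirichlet K s = sin (M * pi * s) / sin (pi * s)"
      using dirichlet_mult_sin[of K s] sin_pos[OF that] by (simp add: M_def eq_divide_eq)
    show ?thesis
      unfolding W_def using sin_pos[OF that] M
      by (auto intro!: derivative_eq_intros simp: field_simps power2_eq_square *)
  qed
  have derivV: "(V has_real_derivative - (cos (pi * s) / (M * (sin (pi * s))\<^sup>2))) (at s)"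
    if "s \<in> {t..1/2}" for s
    unfolding V_def using sin_pos[OF that] M
    by (auto intro!: derivative_eq_intros simp: field_simps power2_eq_square)
  have bd: "\<bar>cos (M * pi * s) * cos (pi * s) / (M * (sin (pi * s))\<^sup>2)\<bar> \<le> cos (pi * s) / (M * (sin (pi * s))\<^sup>2)"
    if "s \<in> {t..1/2}" for s
  proof -
    have "cos (pi * s) \<ge> 0"
      using that assms by (intro cos_ge_zero) (auto intro: order.trans[of _ 0])
    then show ?thesis
      using M by (auto simp: abs_mult intro!: divide_right_mono mult_left_le_one_le)
  qed
  have 1: "W t + V t \<ge> W (1/2) + V (1/2)"
  proof (rule DERIV_nonpos_imp_nonincreasing[of t "1/2" "\<lambda>s. W s + V s"])
    fix s assume "t \<le> s" "s \<le> 1/2"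
    then have s: "s \<in> {t..1/2}" by simp
    show "\<exists>y. ((\<lambda>s. W s + V s) has_real_derivative y) (at s) \<and> y \<le> 0"
      by (rule exI, rule conjI[OF DERIV_add[OF derivW[OF s] derivV[OF s]]])
         (use bd[OF s] in linarith)
  qed (use assms in auto)
  have 2: "W t - V t \<le> W (1/2) - V (1/2)"
  proof (rule DERIV_nonneg_imp_nondecreasing[of t "1/2" "\<lambda>s. W s - V s"])
    fix s assume "t \<le> s" "s \<le> 1/2"
    then have s: "s \<in> {t..1/2}" by simp
    show "\<exists>y. ((\<lambda>s. W s - V s) has_real_derivative y) (at s) \<and> 0 \<le> y"
      by (rule exI, rule conjI[OF DERIV_diff[OF derivW[OF s] derivV[OF s]]])
         (use bd[OF s] in linarith)
  qed (use assms in auto)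
  \<comment> \<open>Oddness and the rule for a shift by 1 force the value at the midpoint of the
    period; the boundary term vanishes there because \<open>M\<close> is odd.\<close>
  have "dirichlet_int K (1/2) = 1/2"
    using dirichlet_int_add_int[of K "-(1/2)" 1] by (simp only: dirichlet_int_minus) simp
  moreover have "cos (M * pi * (1/2)) = 0"
  proof -
    have "M * pi * (1/2) = real K * pi + pi / 2"
      by (simp add: M_def field_simps)
    then show ?thesis by (simp only: cos_add) simp
  qed
  ultimately have "W (1/2) = 1/2" by (simp add: W_def)
  moreover have "V (1/2) > 0" using M by (simp add: V_def)
  ultimately have "\<bar>W t - 1/2\<bar> \<le> V t" using 1 2 by linarith
  moreover have "\<bar>dirichlet_int K t - W t\<bar> \<le> V t"
    using sin_pos[of t] assms M
    by (auto simp: W_def V_def abs_mult intro!: divide_right_mono)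
  ultimately have "\<bar>dirichlet_int K t - 1/2\<bar> \<le> 2 * V t" by linarith
  also have "\<dots> \<le> 1 / (M * sin (pi * t))"
    using sin_pos[of t] assms M pi_gt3 by (simp add: V_def field_simps)
  finally show ?thesis
    using sin_pos[of t] assms M(1) unfolding M_def[symmetric]
    by (simp only: pos_le_divide_eq mult_pos_pos atLeastAtMost_iff order_refl simp_thms) (simp add: mult.assoc mult.commute)
qed

text \<open>Transfers a property of the error from the half period to all non-integers: reflection
  at 1/2 negates the error and integer shifts preserve it. It is applied to two different
  bounds.\<close>

lemma dirichlet_int_error_by_periodicity:
  fixes Q :: "real \<Rightarrow> real \<Rightarrow> bool"
  assumes half: "\<And>t. 0 < t \<Longrightarrow> t \<le> 1 / 2 \<Longrightarrow> Q t (dirichlet_int K t - 1 / 2)"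
    and refl: "\<And>t d. Q t d \<Longrightarrow> Q (1 - t) (- d)"
    and shift: "\<And>t d n. Q t d \<Longrightarrow> Q (t + of_int n) d"
    and "t \<notin> \<int>"
  shows "Q t (dirichlet_int K t - mid_floor t)"
proof -
  have *: "Q s (dirichlet_int K s - 1 / 2)" if "0 < s" "s < 1" for s
  proof (cases "s \<le> 1 / 2")
    case False
    have "dirichlet_int K (1 - s) = 1 - dirichlet_int K s"
      using dirichlet_int_add_int[of K "-s" 1] by (simp add: algebra_simps)
    then show ?thesis
      using refl[OF half[of "1 - s"]] that False by auto
  qed (use half that in auto)
  have "0 < frac t" "frac t < 1"
    using \<open>t \<notin> \<int>\<close> by (auto simp: frac_lt_1)
  from shift[OF *[OF this], of "\<lfloor>t\<rfloor>"] show ?thesis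
    using \<open>t \<notin> \<int>\<close> dirichlet_int_add_int[of K "frac t" "\<lfloor>t\<rfloor>"]
    by (simp add: mid_floor_def frac_def algebra_simps)
qed

lemma abs_sin_pi_add_int: "\<bar>sin (pi * (t + of_int n))\<bar> = \<bar>sin (pi * t)\<bar>"
  by (cases "even n") (simp_all add: distrib_left sin_add abs_mult)

lemma dirichlet_int_bound:
  "\<bar>dirichlet_int K t - mid_floor t\<bar> * \<bar>sin (pi * t)\<bar> \<le> 1 / (2 * real K + 1)"
proof (cases "t \<in> \<int>")
  case False
  show ?thesis
  proof (rule dirichlet_int_error_by_periodicity[where Q = "\<lambda>t d. \<bar>d\<bar> * \<bar>sin (pi * t)\<bar> \<le> 1 / (2 * real K + 1)"])
    fix t :: real assume t: "0 < t" "t \<le> 1 / 2"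
    then have "sin (pi * t) \<ge> 0" by (intro sin_ge_zero) auto
    then show "\<bar>dirichlet_int K t - 1 / 2\<bar> * \<bar>sin (pi * t)\<bar> \<le> 1 / (2 * real K + 1)"
      using dirichlet_int_bound_half[OF t, of K] by simp
  qed (simp_all add: abs_sin_pi_add_int right_diff_distrib sin_diff False)
qed (auto simp: mid_floor_def elim!: Ints_cases)

lemma abs_dirichlet_int_diff_le:
  assumes "\<And>s. s \<in> closed_segment t u \<Longrightarrow> \<bar>dirichlet K s\<bar> \<le> M"
  shows "\<bar>dirichlet_int K t - dirichlet_int K u\<bar> \<le> M * \<bar>t - u\<bar>"
proof -
  have "norm (dirichlet_int K t - dirichlet_int K u) \<le> M * norm (t - u)"
    by (rule field_differentiable_bound[of "closed_segment t u" _ "dirichlet K"])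
       (use assms has_field_derivative_dirichlet_int[OF DERIV_ident, of K] in auto)
  then show ?thesis by simp
qed

text \<open>A uniform bound in spite of the Gibbs overshoot. Up to \<open>t = 1 / (2K + 1)\<close>
  the primitive is at most 1 by the size of its derivative; beyond that the decay bound and Jordan's
  inequality apply.\<close>

lemma dirichlet_int_diff_mid_floor_le: "\<bar>dirichlet_int K t - mid_floor t\<bar> \<le> 3 / 2"
proof (cases "t \<in> \<int>")
  case False
  show ?thesis
  proof (rule dirichlet_int_error_by_periodicity[where Q = "\<lambda>t d. \<bar>d\<bar> \<le> 3 / 2"])
    fix t :: real assume t: "0 < t" "t \<le> 1 / 2"
    show "\<bar>dirichlet_int K t - 1 / 2\<bar> \<le> 3 / 2"
    proof (cases "(2 * real K + 1) * t \<le> 1")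
      case True
      have "\<bar>dirichlet_int K t - dirichlet_int K 0\<bar> \<le> (2 * real K + 1) * \<bar>t - 0\<bar>"
        by (intro abs_dirichlet_int_diff_le abs_dirichlet_le)
      then have "\<bar>dirichlet_int K t\<bar> \<le> 1" using True t by auto
      then show ?thesis by linarith
    next
      case False
      have "\<bar>dirichlet_int K t - 1 / 2\<bar> * (2 * t) \<le> \<bar>dirichlet_int K t - 1 / 2\<bar> * sin (pi * t)"
        using t by (intro mult_left_mono sin_pi_ge) auto
      also have "\<dots> \<le> 1 / (2 * real K + 1)"
        by (rule dirichlet_int_bound_half[OF t])
      also have "\<dots> \<le> t"
        using False by (simp add: field_simps)
      finally have "\<bar>dirichlet_int K t - 1 / 2\<bar> * 2 \<le> 1"
        using t by (simp add: mult.assoc[symmetric])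
      then show ?thesis by simp
    qed
  qed (simp_all add: False)
qed (auto simp: mid_floor_def elim!: Ints_cases)

lemma sin_pi_eq_0_iff: "sin (pi * t) = 0 \<longleftrightarrow> t \<in> \<int>"
  by (auto simp: sin_zero_iff_int2 Ints_def mult.commute)

lemma dirichlet_int_tendsto: "(\<lambda>K. dirichlet_int K t) \<longlonglongrightarrow> mid_floor t"
proof (cases "t \<in> \<int>")
  case False
  then have s: "\<bar>sin (pi * t)\<bar> > 0" by (simp add: sin_pi_eq_0_iff)
  have "(\<lambda>K. dirichlet_int K t - mid_floor t) \<longlonglongrightarrow> 0"
  proof (rule Lim_null_comparison)
    show "\<forall>\<^sub>F K in sequentially. norm (dirichlet_int K t - mid_floor t)
        \<le> 1 / \<bar>sin (pi * t)\<bar> * inverse (real (Suc K))"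
    proof (intro always_eventually allI)
      fix K
      have "\<bar>dirichlet_int K t - mid_floor t\<bar> \<le> 1 / (2 * real K + 1) / \<bar>sin (pi * t)\<bar>"
        unfolding pos_le_divide_eq[OF s] by (rule dirichlet_int_bound)
      also have "\<dots> \<le> 1 / \<bar>sin (pi * t)\<bar> * inverse (real (Suc K))"
        using s by (simp add: divide_simps)
      finally show "norm (dirichlet_int K t - mid_floor t) \<le> 1 / \<bar>sin (pi * t)\<bar> * inverse (real (Suc K))"
        by simp
    qed
    show "(\<lambda>K. 1 / \<bar>sin (pi * t)\<bar> * inverse (real (Suc K))) \<longlonglongrightarrow> 0"
      by (intro tendsto_mult_right_zero LIMSEQ_inverse_real_of_nat)
  qed
  then show ?thesis by (simp add: LIM_zero_iff)
qed (auto simp: mid_floor_def elim!: Ints_cases)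

subsection \<open>The staircase approximation along the arc\<close>

text \<open>The form \<open>D\<^sub>K(u) du\<close> pulled back to the arc by
  \<open>u = A sin \<theta>\<close>; it is the derivative of
  \<open>dirichlet_int K (A * sin \<theta>)\<close>.\<close>

definition dirichlet_arc :: "real \<Rightarrow> nat \<Rightarrow> real \<Rightarrow> real" where
  "dirichlet_arc A K \<theta> = A * cos \<theta> * dirichlet K (A * sin \<theta>)"

text \<open>Agrees with \<open>mid_floor (B * cos \<theta>)\<close> except at the finitely many
  angles of the quarter arc where \<open>B * cos \<theta>\<close> is an integer, and integrates as a
  plain step function.\<close>

definition stair :: "real \<Rightarrow> real \<Rightarrow> real" where
  "stair B \<theta> = of_int \<lfloor>B * cos \<theta>\<rfloor> + 1 / 2"

lemma continuous_on_dirichlet_arc: "continuous_on S (dirichlet_arc A K)"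
  unfolding dirichlet_arc_def by (intro continuous_intros)

lemma dirichlet_arc_has_integral:
  assumes "c \<le> d"
  shows "(dirichlet_arc A K has_integral dirichlet_int K (A * sin d) - dirichlet_int K (A * sin c)) {c..d}"
  unfolding dirichlet_arc_def
  by (rule fundamental_theorem_of_calculus[OF assms])
     (auto simp flip: has_real_derivative_iff_has_vector_derivative intro!: derivative_eq_intros)

text \<open>Bounded convergence with an exceptional null set, so that the angles where the pointwise
  estimates fail can be discarded by redefining the functions to be 0 there.\<close>

lemma integral_tendsto_0_bounded:
  fixes f :: "nat \<Rightarrow> real \<Rightarrow> real"
  assumes int: "\<And>k. f k integrable_on {a..b}"
    and N: "negligible N"
    and bound: "\<And>k x. x \<in> {a..b} - N \<Longrightarrow> \<bar>f k x\<bar> \<le> C"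
    and conv: "\<And>x. x \<in> {a..b} - N \<Longrightarrow> (\<lambda>k. f k x) \<longlonglongrightarrow> 0"
  shows "(\<lambda>k. integral {a..b} (f k)) \<longlonglongrightarrow> 0"
proof -
  define g where "g k x = (if x \<in> N then 0 else f k x)" for k x
  have g: "g k integrable_on {a..b}" for k
    by (rule integrable_spike[OF int N]) (simp add: g_def)
  have eq: "integral {a..b} (f k) = integral {a..b} (g k)" for k
    by (rule integral_spike[OF N]) (simp add: g_def)
  have "(\<lambda>k. integral {a..b} (g k)) \<longlonglongrightarrow> integral {a..b} (\<lambda>x. 0)"
  proof (rule dominated_convergence(2)[where h = "\<lambda>_. \<bar>C\<bar>", OF g integrable_const_ivl])
    show "norm (g k x) \<le> \<bar>C\<bar>" if "x \<in> {a..b}" for k x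
      using bound[of x k] that by (auto simp: g_def)
    show "(\<lambda>k. g k x) \<longlonglongrightarrow> 0" if "x \<in> {a..b}" for x
      using conv[of x] that by (cases "x \<in> N") (auto simp: g_def)
  qed
  then show ?thesis by (simp add: eq)
qed

text \<open>The floor of \<open>B * cos \<theta>\<close> counts the q \<ge> 1 with
  \<open>q \<le> B * cos \<theta>\<close>, that is, with
  \<open>\<theta> \<le> arccos (q / B)\<close>. So the staircase is 1/2 plus a sum of indicators of
  initial intervals.\<close>

lemma stair_has_integral:
  assumes f: "continuous_on {0..pi/2} f" and B: "B > 0"
  shows "((\<lambda>\<theta>. f \<theta> * stair B \<theta>) has_integral
      (integral {0..pi/2} f / 2 + (\<Sum>q = 1..nat \<lfloor>B\<rfloor>. integral {0..arccos (real q / B)} f))) {0..pi/2}"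
proof -
  have eq: "f \<theta> * stair B \<theta> = f \<theta> / 2 + (\<Sum>q = 1..nat \<lfloor>B\<rfloor>. if \<theta> \<in> {0..arccos (real q / B)} then f \<theta> else 0)"
    if \<theta>: "\<theta> \<in> {0..pi/2}" for \<theta>
  proof -
    have c: "0 \<le> cos \<theta>" using \<theta> by (intro cos_ge_zero) auto
    have "B * cos \<theta> \<le> B" using B by simp
    then have le: "\<lfloor>B * cos \<theta>\<rfloor> \<le> \<lfloor>B\<rfloor>" by (rule floor_mono)
    have "\<theta> \<in> {0..arccos (real q / B)} \<longleftrightarrow> q \<le> nat \<lfloor>B * cos \<theta>\<rfloor>" if "q \<in> {1..nat \<lfloor>B\<rfloor>}" for q
    proof -
      have "real q \<le> B" using that by (intro order.trans[OF of_nat_mono of_nat_floor]) (use B in auto)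
      then have q: "0 \<le> real q / B" "real q / B \<le> 1" using B by auto
      have "\<theta> \<le> arccos (real q / B) \<longleftrightarrow> real q / B \<le> cos \<theta>"
        using arccos_le_mono[of "cos \<theta>" "real q / B"] \<theta> q by (auto simp: arccos_cos)
      also have "\<dots> \<longleftrightarrow> real q \<le> B * cos \<theta>"
        using B by (simp add: field_simps)
      also have "\<dots> \<longleftrightarrow> q \<le> nat \<lfloor>B * cos \<theta>\<rfloor>"
        using c B by (simp add: le_nat_iff le_floor_iff)
      finally show ?thesis using \<theta> by simp
    qed
    then have "(\<Sum>q = 1..nat \<lfloor>B\<rfloor>. if \<theta> \<in> {0..arccos (real q / B)} then f \<theta> else 0)
        = (\<Sum>q = 1..nat \<lfloor>B\<rfloor>. if q \<le> nat \<lfloor>B * cos \<theta>\<rfloor> then f \<theta> else 0)"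
      by (intro sum.cong refl) (simp only:)
    also have "\<dots> = (\<Sum>q \<in> {1..nat \<lfloor>B * cos \<theta>\<rfloor>}. f \<theta>)"
      by (rule sum.mono_neutral_cong_right) (use le in auto)
    also have "\<dots> = of_int \<lfloor>B * cos \<theta>\<rfloor> * f \<theta>"
      using c B by simp
    finally show ?thesis by (simp add: stair_def algebra_simps)
  qed
  have "((\<lambda>\<theta>. f \<theta> / 2 + (\<Sum>q = 1..nat \<lfloor>B\<rfloor>. if \<theta> \<in> {0..arccos (real q / B)} then f \<theta> else 0)) has_integral
      (integral {0..pi/2} f / 2 + (\<Sum>q = 1..nat \<lfloor>B\<rfloor>. integral {0..arccos (real q / B)} f))) {0..pi/2}"
  proof (intro has_integral_add has_integral_sum has_integral_divide)
    show "(f has_integral integral {0..pi/2} f) {0..pi/2}"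
      by (intro integrable_integral integrable_continuous_real f)
    fix q assume "q \<in> {1..nat \<lfloor>B\<rfloor>}"
    then have "real q \<le> B" by (intro order.trans[OF of_nat_mono of_nat_floor]) (use B in auto)
    then have "arccos (real q / B) \<le> pi / 2"
      using B by (intro arccos_le_pi2) auto
    then have sub: "{0..arccos (real q / B)} \<subseteq> {0..pi/2}" by auto
    show "((\<lambda>\<theta>. if \<theta> \<in> {0..arccos (real q / B)} then f \<theta> else 0) has_integral integral {0..arccos (real q / B)} f) {0..pi/2}"
      unfolding has_integral_restrict[OF sub]
      by (intro integrable_integral integrable_continuous_real continuous_on_subset[OF f sub])
  qed auto
  then show ?thesis
    by (subst has_integral_cong[OF eq]) auto
qed

definition arc_error :: "real \<Rightarrow> real \<Rightarrow> nat \<Rightarrow> real \<Rightarrow> real" where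
  "arc_error A B K \<theta> = dirichlet_arc A K \<theta> * (dirichlet_int K (B * cos \<theta>) - stair B \<theta>)"

lemma arc_error_integrable:
  assumes "B > 0" "0 \<le> c" "d \<le> pi / 2"
  shows "arc_error A B K integrable_on {c..d}"
proof -
  have "(\<lambda>\<theta>. dirichlet_arc A K \<theta> * dirichlet_int K (B * cos \<theta>) - dirichlet_arc A K \<theta> * stair B \<theta>) integrable_on {0..pi/2}"
    by (rule integrable_diff)
       (auto intro!: integrable_continuous_real continuous_intros continuous_on_dirichlet_arc
         has_integral_integrable[OF stair_has_integral[OF continuous_on_dirichlet_arc assms(1)]])
  then have "arc_error A B K integrable_on {0..pi/2}"
    by (simp add: arc_error_def[abs_def] algebra_simps)
  then show ?thesis
    by (rule integrable_on_subinterval) (use assms in auto)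
qed

lemma negligible_lattice_angles:
  assumes "A > 0" "B > 0"
  shows "negligible {\<theta> \<in> {0..pi/2}. A * sin \<theta> \<in> \<int> \<or> B * cos \<theta> \<in> \<int>}"
proof (rule negligible_subset)
  let ?N = "range (\<lambda>n. arcsin (of_int n / A)) \<union> range (\<lambda>n. arccos (of_int n / B))"
  have "countable ?N" by simp
  then have "negligible (\<Union>((\<lambda>x. {x}) ` ?N))"
    by (intro negligible_countable_Union) auto
  then show "negligible ?N" by simp
  show "{\<theta> \<in> {0..pi/2}. A * sin \<theta> \<in> \<int> \<or> B * cos \<theta> \<in> \<int>} \<subseteq> ?N"
  proof clarify
    fix \<theta> assume \<theta>: "\<theta> \<in> {0..pi/2}" "A * sin \<theta> \<in> \<int> \<or> B * cos \<theta> \<in> \<int>" "\<theta> \<notin> range (\<lambda>n. arccos (of_int n / B))"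
    show "\<theta> \<in> range (\<lambda>n. arcsin (of_int n / A))"
    proof (cases "A * sin \<theta> \<in> \<int>")
      case True
      then obtain n :: int where "A * sin \<theta> = of_int n" by (auto elim: Ints_cases)
      then have "of_int n / A = sin \<theta>" using assms by (simp add: field_simps)
      then have "\<theta> = arcsin (of_int n / A)" using \<theta> by (simp add: arcsin_sin)
      then show ?thesis by blast
    next
      case False
      then obtain n :: int where "B * cos \<theta> = of_int n" using \<theta> by (auto elim: Ints_cases)
      then have "of_int n / B = cos \<theta>" using assms by (simp add: field_simps)
      then have "\<theta> = arccos (of_int n / B)" using \<theta> by (simp add: arccos_cos)
      then show ?thesis using \<theta> by blast
    qed
  qed
qed

text \<open>
  The product of \<open>\<bar>D\<^sub>K(u)\<bar> \<le> min (2K + 1) (1 / \<bar>sin \<pi>u\<bar>)\<close> and of the error of \<open>R\<^sub>K(v)\<close>, which is at most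
  \<open>min (3/2) (1 / ((2K + 1) \<bar>sin \<pi>v\<bar>))\<close>, is bounded uniformly in \<open>K\<close> by a multiple of
  \<open>1 / (\<bar>sin \<pi>u\<bar> + \<bar>sin \<pi>v\<bar>)\<close>. This is bounded by compactness away from lattice points, and at
  \<open>\<theta> = \<pi>/2\<close> the factor \<open>cos \<theta>\<close> compensates.
\<close>

lemma arc_error_tendsto_0:
  assumes AB: "A > 0" "B > 0" and cd: "0 \<le> c" "d \<le> pi / 2"
    and no_lattice: "\<And>\<theta>. \<theta> \<in> {c..d} \<Longrightarrow> A * sin \<theta> \<in> \<int> \<Longrightarrow> B * cos \<theta> \<in> \<int> \<Longrightarrow> \<theta> = pi / 2"
  shows "(\<lambda>K. integral {c..d} (arc_error A B K)) \<longlonglongrightarrow> 0"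
proof -
  define g where "g \<theta> = \<bar>sin (pi * (A * sin \<theta>))\<bar> + \<bar>sin (pi * (B * cos \<theta>))\<bar>" for \<theta>
  have cos_nonneg: "cos \<theta> \<ge> 0" if "\<theta> \<in> {c..d}" for \<theta>
    using that cd by (intro cos_ge_zero) auto
  obtain m where m: "m > 0" "\<And>\<theta>. \<theta> \<in> {c..d} \<Longrightarrow> m * cos \<theta> \<le> g \<theta>"
  proof -
    \<comment> \<open>Beyond \<open>\<eta>\<close> one has
      \<open>B * cos \<theta> \<le> 1/2\<close>, so Jordan's inequality bounds \<open>g\<close>
      below by a multiple of \<open>cos \<theta>\<close>; before \<open>\<eta>\<close> the angle
      \<open>pi / 2\<close> is excluded and compactness applies. The minimum with 1 keeps the
      argument in the domain of \<open>arccos\<close>.\<close>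
    define \<eta> where "\<eta> = arccos (min 1 (1 / (2 * B)))"
    define y where "y = min 1 (1 / (2 * B))"
    have y: "0 < y" "y \<le> 1" using AB by (auto simp: y_def)
    have \<eta>: "cos \<eta> = y" "0 \<le> \<eta>" "\<eta> < pi / 2"
      using y arccos_less_arccos[of 0 y] unfolding \<eta>_def y_def[symmetric]
      by (auto intro: arccos_lbound)
    have far: "2 * B * cos \<theta> \<le> g \<theta>" if "\<theta> \<in> {c..d}" "\<eta> \<le> \<theta>" for \<theta>
    proof -
      have "cos \<theta> \<le> cos \<eta>" using that \<eta> cd by (intro cos_monotone_0_pi_le) auto
      then have "cos \<theta> \<le> 1 / (2 * B)" using \<eta> by (simp add: y_def)
      then have "B * cos \<theta> \<le> 1 / 2" using AB by (simp add: field_simps)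
      then have "2 * (B * cos \<theta>) \<le> sin (pi * (B * cos \<theta>))"
        using AB cos_nonneg[OF that(1)] by (intro sin_pi_ge) auto
      then show ?thesis by (simp add: g_def)
    qed
    let ?S = "{c..min d \<eta>}"
    have pos: "g \<theta> > 0" if "\<theta> \<in> ?S" for \<theta>
    proof (rule ccontr)
      assume "\<not> g \<theta> > 0"
      then have "sin (pi * (A * sin \<theta>)) = 0" "sin (pi * (B * cos \<theta>)) = 0"
        by (auto simp: g_def)
      then have "\<theta> = pi / 2" using no_lattice[of \<theta>] that by (auto simp: sin_pi_eq_0_iff)
      then show False using \<eta> that by simp
    qed
    obtain m' where m': "m' > 0" "\<And>\<theta>. \<theta> \<in> ?S \<Longrightarrow> m' \<le> g \<theta>"
    proof (cases "?S = {}")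
      case False
      have "continuous_on ?S g"
        unfolding g_def by (intro continuous_intros)
      then obtain \<theta>0 where "\<theta>0 \<in> ?S" "\<And>\<theta>. \<theta> \<in> ?S \<Longrightarrow> g \<theta>0 \<le> g \<theta>"
        using continuous_attains_inf[of ?S g] False by (auto simp del: atLeastAtMost_iff)
      then show ?thesis using that[of "g \<theta>0"] pos by blast
    qed (use that[of 1] in auto)
    show ?thesis
    proof (rule that[of "min (2 * B) m'"])
      fix \<theta> assume \<theta>: "\<theta> \<in> {c..d}"
      show "min (2 * B) m' * cos \<theta> \<le> g \<theta>"
      proof (cases "\<eta> \<le> \<theta>")
        case True
        have "min (2 * B) m' * cos \<theta> \<le> 2 * B * cos \<theta>"
          using cos_nonneg[OF \<theta>] by (intro mult_right_mono) auto
        then show ?thesis using far[OF \<theta> True] by linarith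
      next
        case False
        have "min (2 * B) m' * cos \<theta> \<le> m' * 1"
          using cos_nonneg[OF \<theta>] m' AB by (intro mult_mono) auto
        also have "\<dots> \<le> g \<theta>" using m' \<theta> False by auto
        finally show ?thesis .
      qed
    qed (use AB m' in auto)
  qed
  define N where "N = {\<theta> \<in> {0..pi/2}. A * sin \<theta> \<in> \<int> \<or> B * cos \<theta> \<in> \<int>}"
  have stair_eq: "stair B \<theta> = mid_floor (B * cos \<theta>)" if "\<theta> \<in> {c..d} - N" for \<theta>
    using that cd by (auto simp: N_def stair_def mid_floor_def)
  show ?thesis
  proof (rule integral_tendsto_0_bounded[OF arc_error_integrable])
    show "negligible N"
      unfolding N_def by (rule negligible_lattice_angles[OF AB])
    fix \<theta> assume \<theta>: "\<theta> \<in> {c..d} - N"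
    let ?u = "A * sin \<theta>" and ?v = "B * cos \<theta>"
    show "\<bar>arc_error A B K \<theta>\<bar> \<le> A * (5 / 2) / m" for K
    proof -
      define Q where "Q = \<bar>dirichlet_int K ?v - mid_floor ?v\<bar>"
      define X where "X = \<bar>dirichlet K ?u\<bar> * Q"
      have Q: "0 \<le> Q" "Q \<le> 3 / 2"
        using dirichlet_int_diff_mid_floor_le by (auto simp: Q_def)
      \<comment> \<open>The two summands of \<open>g\<close> use opposite pairs of bounds: decay of
        the kernel with boundedness of the error, then boundedness of the kernel with decay of the
        error. They contribute 3/2 and 1.\<close>
      have "\<bar>dirichlet K ?u\<bar> * \<bar>sin (pi * ?u)\<bar> * Q \<le> 1 * (3 / 2)"
        by (intro mult_mono abs_dirichlet_mult_sin_le Q) auto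
      moreover have "\<bar>dirichlet K ?u\<bar> * (Q * \<bar>sin (pi * ?v)\<bar>) \<le> (2 * real K + 1) * (1 / (2 * real K + 1))"
        unfolding Q_def by (intro mult_mono abs_dirichlet_le dirichlet_int_bound) auto
      ultimately have "X * g \<theta> \<le> 5 / 2"
        by (simp add: X_def g_def algebra_simps)
      moreover have "X * (m * cos \<theta>) \<le> X * g \<theta>"
        using m \<theta> Q by (intro mult_left_mono) (auto simp: X_def)
      ultimately have "X * cos \<theta> \<le> 5 / 2 / m"
        using m(1) by (simp add: field_simps)
      then have "A * (X * cos \<theta>) \<le> A * (5 / 2 / m)"
        using AB by (intro mult_left_mono) auto
      then show ?thesis
        using AB cos_nonneg[of \<theta>] \<theta>
        by (simp add: arc_error_def dirichlet_arc_def stair_eq abs_mult X_def Q_def mult_ac)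
    qed
    \<comment> \<open>At a fixed angle outside \<open>N\<close> the kernel stays bounded in
      \<open>K\<close> while the error of its primitive tends to 0.\<close>
    show "(\<lambda>K. arc_error A B K \<theta>) \<longlonglongrightarrow> 0"
    proof -
      have s: "\<bar>sin (pi * ?u)\<bar> > 0" using \<theta> cd by (auto simp: N_def sin_pi_eq_0_iff)
      show ?thesis
      proof (rule Lim_null_comparison)
        show "\<forall>\<^sub>F K in sequentially. norm (arc_error A B K \<theta>)
            \<le> A * \<bar>cos \<theta>\<bar> / \<bar>sin (pi * ?u)\<bar> * \<bar>dirichlet_int K ?v - mid_floor ?v\<bar>"
        proof (intro always_eventually allI)
          fix K
          have "\<bar>dirichlet K ?u\<bar> \<le> 1 / \<bar>sin (pi * ?u)\<bar>"
            unfolding pos_le_divide_eq[OF s] by (rule abs_dirichlet_mult_sin_le)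
          then have "A * \<bar>cos \<theta>\<bar> * \<bar>dirichlet K ?u\<bar> \<le> A * \<bar>cos \<theta>\<bar> * (1 / \<bar>sin (pi * ?u)\<bar>)"
            using AB by (intro mult_left_mono) auto
          then show "norm (arc_error A B K \<theta>)
              \<le> A * \<bar>cos \<theta>\<bar> / \<bar>sin (pi * ?u)\<bar> * \<bar>dirichlet_int K ?v - mid_floor ?v\<bar>"
            unfolding arc_error_def dirichlet_arc_def stair_eq[OF \<theta>] real_norm_def abs_mult
            using AB by (intro mult_right_mono) auto
        qed
        have "(\<lambda>K. dirichlet_int K ?v - mid_floor ?v) \<longlonglongrightarrow> 0"
          by (intro LIM_zero dirichlet_int_tendsto)
        then show "(\<lambda>K. A * \<bar>cos \<theta>\<bar> / \<bar>sin (pi * ?u)\<bar> * \<bar>dirichlet_int K ?v - mid_floor ?v\<bar>) \<longlonglongrightarrow> 0"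
          by (intro tendsto_mult_right_zero tendsto_rabs_zero)
      qed
    qed
  qed (use AB cd in auto)
qed

section \<open>Cancellation near a lattice point on the arc\<close>

lemma abs_dirichlet_le_inverse:
  assumes "0 < \<bar>t\<bar>" "\<bar>t\<bar> \<le> 1 / 2"
  shows "\<bar>dirichlet K t\<bar> \<le> 1 / (2 * \<bar>t\<bar>)"
proof -
  have "2 * \<bar>t\<bar> \<le> sin (pi * \<bar>t\<bar>)" using assms by (intro sin_pi_ge) auto
  also have "\<dots> \<le> \<bar>sin (pi * t)\<bar>" by (cases "t \<ge> 0") auto
  finally have "\<bar>dirichlet K t\<bar> * (2 * \<bar>t\<bar>) \<le> \<bar>dirichlet K t\<bar> * \<bar>sin (pi * t)\<bar>"
    by (intro mult_left_mono) auto
  also have "\<dots> \<le> 1" by (rule abs_dirichlet_mult_sin_le)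
  finally show ?thesis using assms by (simp add: field_simps)
qed

text \<open>Since \<open>\<mu>\<close> and \<open>\<tau>\<close> have the same sign, the segment
  between them keeps distance \<open>c * \<bar>\<sigma>\<bar>\<close> from 0. The kernel there is at
  most \<open>1 / (2c\<bar>\<sigma>\<bar>)\<close>, so the quadratic closeness makes the difference
  at most \<open>C\<bar>\<sigma>\<bar> / (2c)\<close>, which absorbs the singularity
  \<open>1 / (2\<bar>\<sigma>\<bar>)\<close> of the other factor.\<close>

lemma dirichlet_mult_int_diff_le:
  assumes \<sigma>: "0 < \<bar>\<sigma>\<bar>" "\<bar>\<sigma>\<bar> \<le> 1 / 2"
    and c: "c > 0"
    and \<tau>: "c * \<bar>\<sigma>\<bar> \<le> \<bar>\<tau>\<bar>" "\<bar>\<tau>\<bar> \<le> 1 / 2"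
    and \<mu>: "c * \<bar>\<sigma>\<bar> \<le> \<bar>\<mu>\<bar>" "\<bar>\<mu>\<bar> \<le> 1 / 2"
    and sgn: "sgn \<mu> = sgn \<tau>"
    and close: "\<bar>\<mu> - \<tau>\<bar> \<le> C * \<sigma>\<^sup>2"
  shows "\<bar>dirichlet K \<sigma> * (dirichlet_int K \<mu> - dirichlet_int K \<tau>)\<bar> \<le> C / (4 * c)"
proof -
  have pos: "c * \<bar>\<sigma>\<bar> > 0" using \<sigma> c by simp
  have "\<bar>dirichlet_int K \<mu> - dirichlet_int K \<tau>\<bar> \<le> 1 / (2 * (c * \<bar>\<sigma>\<bar>)) * \<bar>\<mu> - \<tau>\<bar>"
  proof (rule abs_dirichlet_int_diff_le)
    fix s assume "s \<in> closed_segment \<mu> \<tau>"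
    then have s: "c * \<bar>\<sigma>\<bar> \<le> \<bar>s\<bar>" "\<bar>s\<bar> \<le> 1 / 2"
      using \<tau> \<mu> sgn pos
      by (auto simp: closed_segment_eq_real_ivl sgn_if abs_if split: if_splits)
    then have "\<bar>dirichlet K s\<bar> \<le> 1 / (2 * \<bar>s\<bar>)"
      using pos by (intro abs_dirichlet_le_inverse) auto
    also have "\<dots> \<le> 1 / (2 * (c * \<bar>\<sigma>\<bar>))"
      using s pos by (intro divide_left_mono) auto
    finally show "\<bar>dirichlet K s\<bar> \<le> 1 / (2 * (c * \<bar>\<sigma>\<bar>))" .
  qed
  also have "\<dots> \<le> 1 / (2 * (c * \<bar>\<sigma>\<bar>)) * (C * \<sigma>\<^sup>2)"
    using pos by (intro mult_left_mono close) auto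
  also have "\<dots> = C * \<bar>\<sigma>\<bar> / (2 * c)"
    using c \<sigma> by (simp add: field_simps power2_eq_square)
  finally have "\<bar>dirichlet K \<sigma>\<bar> * \<bar>dirichlet_int K \<mu> - dirichlet_int K \<tau>\<bar>
      \<le> 1 / (2 * \<bar>\<sigma>\<bar>) * (C * \<bar>\<sigma>\<bar> / (2 * c))"
    by (intro mult_mono abs_dirichlet_le_inverse \<sigma>) auto
  also have "\<dots> = C / (4 * c)" using \<sigma> by (simp add: field_simps)
  finally show ?thesis by (simp add: abs_mult)
qed

text \<open>Both primitives tend to the same value 1/2 or -1/2, given by the common sign, while the
  factor \<open>dirichlet K \<sigma>\<close> stays bounded.\<close>

lemma dirichlet_mult_int_diff_tendsto_0:
  assumes "0 < \<bar>\<tau>\<bar>" "\<bar>\<tau>\<bar> \<le> 1 / 2" "0 < \<bar>\<mu>\<bar>" "\<bar>\<mu>\<bar> \<le> 1 / 2" "0 < \<bar>\<sigma>\<bar>" "\<bar>\<sigma>\<bar> \<le> 1 / 2"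
    and sgn: "sgn \<mu> = sgn \<tau>"
  shows "(\<lambda>K. dirichlet K \<sigma> * (dirichlet_int K \<mu> - dirichlet_int K \<tau>)) \<longlonglongrightarrow> 0"
proof (rule Lim_null_comparison)
  show "\<forall>\<^sub>F K in sequentially. norm (dirichlet K \<sigma> * (dirichlet_int K \<mu> - dirichlet_int K \<tau>))
      \<le> 1 / (2 * \<bar>\<sigma>\<bar>) * \<bar>dirichlet_int K \<mu> - dirichlet_int K \<tau>\<bar>"
    unfolding real_norm_def abs_mult
    by (intro always_eventually allI mult_right_mono abs_dirichlet_le_inverse assms) auto
  have half: "mid_floor t = 1 / 2 * sgn t" if "0 < \<bar>t\<bar>" "\<bar>t\<bar> \<le> 1 / 2" for t
  proof -
    have "t \<notin> \<int>" using that by (auto elim!: Ints_cases)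
    moreover have "\<lfloor>t\<rfloor> = (if t > 0 then 0 else -1)"
      using that by (auto simp: floor_eq_iff)
    ultimately show ?thesis using that by (auto simp: mid_floor_def sgn_if)
  qed
  have "(\<lambda>K. dirichlet_int K \<mu> - dirichlet_int K \<tau>) \<longlonglongrightarrow> mid_floor \<mu> - mid_floor \<tau>"
    by (intro tendsto_diff dirichlet_int_tendsto)
  also have "mid_floor \<mu> - mid_floor \<tau> = 0"
    using assms by (simp add: half)
  finally show "(\<lambda>K. 1 / (2 * \<bar>\<sigma>\<bar>) * \<bar>dirichlet_int K \<mu> - dirichlet_int K \<tau>\<bar>) \<longlonglongrightarrow> 0"
    by (intro tendsto_mult_right_zero tendsto_rabs_zero)
qed

lemma integral_odd_eq_0:
  fixes f :: "real \<Rightarrow> real"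
  assumes "\<And>x. f (- x) = - f x"
  shows "integral {-s..s} f = 0"
  using Henstock_Kurzweil_Integration.integral_reflect_real[of s "-s" f] assms by simp

text \<open>
  With \<open>\<sigma> = A sin \<theta> - p\<close> and \<open>\<tau> = q - B cos \<theta>\<close> the equation of the ellipse gives
  \<open>\<tau> = l \<sigma> + O(\<sigma>\<^sup>2)\<close>. The integral of \<open>D\<^sub>K(\<sigma>) R\<^sub>K(l \<sigma>) d\<sigma>\<close> over a symmetric interval vanishes by oddness,
  and \<open>D\<^sub>K(\<sigma>) (R\<^sub>K(l \<sigma>) - R\<^sub>K(\<tau>))\<close> is bounded uniformly in \<open>K\<close>.
\<close>

lemma arc_error_near_lattice_point:
  fixes p q :: int
  assumes AB: "A > 0" "B > 0" and pq: "p > 0" "q > 0"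
    and \<theta>0: "\<theta>0 \<in> {0..pi/2}" "A * sin \<theta>0 = of_int p" "B * cos \<theta>0 = of_int q"
  obtains c d where "0 \<le> c" "c < \<theta>0" "\<theta>0 < d" "d \<le> pi / 2"
    "(\<lambda>K. integral {c..d} (arc_error A B K)) \<longlonglongrightarrow> 0"
proof -
  \<comment> \<open>The ratio \<open>\<tau> / \<sigma>\<close> equals
    \<open>r (p + A sin \<theta>) / (q + B cos \<theta>)\<close>. Its value at
    \<open>\<theta>0\<close> is \<open>l\<close>; replacing sine and cosine by their extreme values
    gives the bounds \<open>c1\<close> and \<open>c2\<close>. \<open>C\<close> bounds the
    second-order remainder.\<close>
  define r where "r = B\<^sup>2 / A\<^sup>2"
  define c1 where "c1 = r * p / (q + B)"
  define c2 where "c2 = r * (p + A) / q"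
  define l where "l = r * p / q"
  define C where "C = (r + c2\<^sup>2) / (2 * q)"
  have r: "r > 0" using AB by (simp add: r_def)
  have c1: "c1 > 0" "c1 \<le> l" "l \<le> c2"
    using r AB pq unfolding c1_def c2_def l_def
    by (auto intro!: divide_pos_pos mult_pos_pos divide_left_mono divide_right_mono mult_left_mono)
  have c2: "c2 > 0" using c1 by linarith
  have p_lt: "of_int p < A"
  proof -
    have "cos \<theta>0 > 0" using \<theta>0 AB pq by (metis of_int_0_less_iff zero_less_mult_pos)
    then have "(sin \<theta>0)\<^sup>2 < 1" by (simp add: sin_squared_eq)
    then have "sin \<theta>0 < 1" by (metis one_power2 power2_less_imp_less zero_le_one)
    then show ?thesis using \<theta>0 AB by (metis mult.right_neutral mult_strict_left_mono)
  qed
  \<comment> \<open>The half-width in the variable \<open>\<sigma>\<close>: small enough that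
    \<open>\<sigma>\<close>, \<open>\<tau>\<close> and \<open>l * \<sigma>\<close> stay in
    \<open>[-1/2, 1/2]\<close> and that \<open>p - s\<close> and \<open>p + s\<close> lie strictly
    between 0 and \<open>A\<close>.\<close>
  define s where "s = min (min (1 / 2) (1 / (2 * c2))) (min (p / 2) ((A - p) / 2))"
  have s: "0 < s" "s \<le> 1 / 2" "c2 * s \<le> 1 / 2" "s < p" "p + s < A"
  proof -
    have "s \<le> 1 / (2 * c2)" by (simp add: s_def)
    then show "c2 * s \<le> 1 / 2" using c2 by (simp add: field_simps)
    have "s \<le> p / 2" "s \<le> (A - p) / 2" unfolding s_def by linarith+
    then show "s < p" "p + s < A" using pq p_lt by auto
  qed (use c2 pq p_lt in \<open>auto simp: s_def\<close>)
  define c where "c = arcsin ((p - s) / A)"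
  define d where "d = arcsin ((p + s) / A)"
  have bnd: "-1 \<le> (p - s) / A" "(p - s) / A \<le> 1" "-1 \<le> (p + s) / A" "(p + s) / A \<le> 1"
    using AB s by (auto simp: field_simps)
  have sin_cd: "A * sin c = p - s" "A * sin d = p + s"
    using AB bnd by (simp_all add: c_def d_def sin_arcsin)
  have \<theta>0_eq: "\<theta>0 = arcsin (p / A)"
  proof -
    have "p / A = sin \<theta>0" using AB \<theta>0 by (simp add: field_simps)
    then show ?thesis using \<theta>0 by (simp add: arcsin_sin)
  qed
  have "d \<le> pi / 2" using arcsin_ubound[OF bnd(3,4)] by (simp add: d_def)
  moreover have "0 \<le> c" "c < \<theta>0" "\<theta>0 < d"
    unfolding c_def d_def \<theta>0_eq
    using AB s bnd pq p_lt
    by (auto intro!: arcsin_less_arcsin arcsin_nonneg simp: divide_strict_right_mono field_simps)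
  ultimately have cd: "0 \<le> c" "c < \<theta>0" "\<theta>0 < d" "d \<le> pi / 2" by simp_all
  define \<sigma> where "\<sigma> \<theta> = A * sin \<theta> - p" for \<theta>
  define \<tau> where "\<tau> \<theta> = q - B * cos \<theta>" for \<theta>
  have \<sigma>_le: "\<bar>\<sigma> \<theta>\<bar> \<le> s" if "\<theta> \<in> {c..d}" for \<theta>
  proof -
    have "sin c \<le> sin \<theta>" "sin \<theta> \<le> sin d"
      using that cd by (auto intro!: sin_monotone_2pi_le)
    then have "A * sin c \<le> A * sin \<theta>" "A * sin \<theta> \<le> A * sin d"
      using AB by auto
    then show ?thesis by (simp add: \<sigma>_def sin_cd abs_le_iff)
  qed
  have eqn: "r * (\<sigma> \<theta> * (p + A * sin \<theta>)) = \<tau> \<theta> * (q + B * cos \<theta>)" for \<theta>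
  proof -
    have circ: "A\<^sup>2 * (B * cos t)\<^sup>2 = A\<^sup>2 * B\<^sup>2 - B\<^sup>2 * (A * sin t)\<^sup>2" for t
      by (simp add: power_mult_distrib cos_squared_eq algebra_simps)
    have "B\<^sup>2 * (\<sigma> \<theta> * (p + A * sin \<theta>)) = B\<^sup>2 * (A * sin \<theta>)\<^sup>2 - B\<^sup>2 * (A * sin \<theta>0)\<^sup>2"
      unfolding \<theta>0 by (simp add: \<sigma>_def algebra_simps power2_eq_square)
    also have "\<dots> = A\<^sup>2 * (B * cos \<theta>0)\<^sup>2 - A\<^sup>2 * (B * cos \<theta>)\<^sup>2"
      unfolding circ by simp
    also have "\<dots> = A\<^sup>2 * (\<tau> \<theta> * (q + B * cos \<theta>))"
      unfolding \<theta>0 by (simp add: \<tau>_def algebra_simps power2_eq_square)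
    finally show ?thesis using AB by (simp add: r_def field_simps)
  qed
  have geom: "c1 * \<bar>\<sigma> \<theta>\<bar> \<le> \<bar>\<tau> \<theta>\<bar>" "\<bar>\<tau> \<theta>\<bar> \<le> c2 * \<bar>\<sigma> \<theta>\<bar>" "sgn (\<tau> \<theta>) = sgn (\<sigma> \<theta>)"
    if "\<theta> \<in> {c..d}" for \<theta>
  proof -
    have sc: "0 \<le> sin \<theta>" "0 \<le> cos \<theta>"
      using that cd by (auto intro!: sin_ge_zero cos_ge_zero)
    have AB': "0 \<le> A * sin \<theta>" "A * sin \<theta> \<le> A" "0 \<le> B * cos \<theta>" "B * cos \<theta> \<le> B"
      using AB sc by auto
    define k where "k = r * (p + A * sin \<theta>) / (q + B * cos \<theta>)"
    have "q + B * cos \<theta> > 0" using pq AB' by (simp add: add_pos_nonneg)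
    then have \<tau>: "\<tau> \<theta> = k * \<sigma> \<theta>"
      using eqn[of \<theta>] by (simp add: k_def field_simps)
    have "c1 \<le> k" "k \<le> c2"
      unfolding k_def c1_def c2_def using pq r AB' AB
      by (auto intro!: frac_le mult_left_mono mult_pos_pos mult_nonneg_nonneg add_pos_nonneg)
    then show "c1 * \<bar>\<sigma> \<theta>\<bar> \<le> \<bar>\<tau> \<theta>\<bar>" "\<bar>\<tau> \<theta>\<bar> \<le> c2 * \<bar>\<sigma> \<theta>\<bar>" "sgn (\<tau> \<theta>) = sgn (\<sigma> \<theta>)"
      using c1(1) by (auto simp: \<tau> abs_mult sgn_mult intro!: mult_right_mono)
  qed
  have close: "\<bar>l * \<sigma> \<theta> - \<tau> \<theta>\<bar> \<le> C * (\<sigma> \<theta>)\<^sup>2" if "\<theta> \<in> {c..d}" for \<theta>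
  proof -
    have "r * (\<sigma> \<theta> * (2 * of_int p + \<sigma> \<theta>)) = \<tau> \<theta> * (2 * of_int q - \<tau> \<theta>)"
      using eqn[of \<theta>] by (simp add: \<sigma>_def \<tau>_def)
    moreover have "l * q = r * p" using pq by (simp add: l_def)
    \<comment> \<open>The ellipse equation in the local coordinates, with its linear part isolated:
      the deviation from the tangent is exactly quadratic.\<close>
    ultimately have "(\<tau> \<theta> - l * \<sigma> \<theta>) * (2 * of_int q) = r * (\<sigma> \<theta>)\<^sup>2 + (\<tau> \<theta>)\<^sup>2"
      by algebra
    then have "\<tau> \<theta> - l * \<sigma> \<theta> = (r * (\<sigma> \<theta>)\<^sup>2 + (\<tau> \<theta>)\<^sup>2) / (2 * q)"
      using pq by (simp add: eq_divide_eq)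
    moreover have "(\<tau> \<theta>)\<^sup>2 \<le> (c2 * \<sigma> \<theta>)\<^sup>2"
      using geom(2)[OF that] c2 by (intro abs_le_square_iff[THEN iffD1]) (simp add: abs_mult)
    ultimately have "\<bar>\<tau> \<theta> - l * \<sigma> \<theta>\<bar> \<le> (r * (\<sigma> \<theta>)\<^sup>2 + (c2 * \<sigma> \<theta>)\<^sup>2) / (2 * q)"
      using r pq by (simp add: divide_right_mono)
    then show ?thesis
      by (simp add: C_def abs_minus_commute power_mult_distrib algebra_simps)
  qed
  have l: "0 < l" "l * s \<le> 1 / 2"
    using c1 s mult_right_mono[of l c2 s] by linarith+
  have \<tau>_le: "\<bar>\<tau> \<theta>\<bar> \<le> 1 / 2" if "\<theta> \<in> {c..d}" for \<theta>
    using geom(2)[OF that] mult_left_mono[OF \<sigma>_le[OF that], of c2] c2 s(3) by linarith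
  have l_le: "\<bar>l * \<sigma> \<theta>\<bar> \<le> 1 / 2" if "\<theta> \<in> {c..d}" for \<theta>
  proof -
    have "\<bar>l * \<sigma> \<theta>\<bar> = l * \<bar>\<sigma> \<theta>\<bar>" using l by (simp add: abs_mult)
    also have "\<dots> \<le> l * s" using l by (intro mult_left_mono \<sigma>_le[OF that]) auto
    finally show ?thesis using l by linarith
  qed
  have dir: "dirichlet K (A * sin \<theta>) = dirichlet K (\<sigma> \<theta>)" for K \<theta>
    using dirichlet_add_int[of K "\<sigma> \<theta>" p] by (simp add: \<sigma>_def)
  have int: "dirichlet_int K (B * cos \<theta>) = q - dirichlet_int K (\<tau> \<theta>)" for K \<theta>
    using dirichlet_int_add_int[of K "- \<tau> \<theta>" q] unfolding dirichlet_int_minus by (simp add: \<tau>_def)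
  define g where "g K \<theta> = A * cos \<theta> * (dirichlet K (\<sigma> \<theta>) * (dirichlet_int K (l * \<sigma> \<theta>) - dirichlet_int K (\<tau> \<theta>)))" for K \<theta>
  have "(\<lambda>K. integral {c..d} (g K)) \<longlonglongrightarrow> 0"
  proof (rule integral_tendsto_0_bounded[where N = "{\<theta>0}" and C = "A * (C / (4 * c1))"])
    show "g K integrable_on {c..d}" for K
      unfolding g_def \<sigma>_def \<tau>_def by (intro integrable_continuous_real continuous_intros)
    fix \<theta> assume \<theta>: "\<theta> \<in> {c..d} - {\<theta>0}"
    have "\<sigma> \<theta> \<noteq> 0"
    proof
      assume "\<sigma> \<theta> = 0"
      then have "sin \<theta> = p / A" using AB by (simp add: \<sigma>_def field_simps)
      moreover have "arcsin (sin \<theta>) = \<theta>" using \<theta> cd by (intro arcsin_sin) auto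
      ultimately have "\<theta> = \<theta>0" by (simp add: \<theta>0_eq)
      then show False using \<theta> by simp
    qed
    then have \<sigma>: "0 < \<bar>\<sigma> \<theta>\<bar>" "\<bar>\<sigma> \<theta>\<bar> \<le> 1 / 2"
      using \<sigma>_le[of \<theta>] \<theta> s by auto
    have \<tau>\<mu>: "\<bar>\<tau> \<theta>\<bar> \<le> 1 / 2" "\<bar>l * \<sigma> \<theta>\<bar> \<le> 1 / 2"
      using \<tau>_le l_le \<theta> by auto
    have low: "c1 * \<bar>\<sigma> \<theta>\<bar> \<le> \<bar>l * \<sigma> \<theta>\<bar>" "c1 * \<bar>\<sigma> \<theta>\<bar> \<le> \<bar>\<tau> \<theta>\<bar>"
      using c1 geom(1)[of \<theta>] \<theta> by (auto simp: abs_mult intro!: mult_right_mono)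
    moreover have "c1 * \<bar>\<sigma> \<theta>\<bar> > 0" using \<sigma> c1 by simp
    ultimately have pos: "0 < \<bar>\<tau> \<theta>\<bar>" "0 < \<bar>l * \<sigma> \<theta>\<bar>" by linarith+
    have sg: "sgn (l * \<sigma> \<theta>) = sgn (\<tau> \<theta>)"
      using geom(3)[of \<theta>] \<theta> l by (simp add: sgn_mult)
    have cl: "\<bar>l * \<sigma> \<theta> - \<tau> \<theta>\<bar> \<le> C * (\<sigma> \<theta>)\<^sup>2" using close \<theta> by simp
    show "\<bar>g K \<theta>\<bar> \<le> A * (C / (4 * c1))" for K
    proof -
      have "\<bar>A * cos \<theta>\<bar> \<le> A" using AB by (simp add: abs_mult)
      then show ?thesis
        unfolding g_def abs_mult[of "A * cos \<theta>"]
        by (intro mult_mono dirichlet_mult_int_diff_le[OF \<sigma> c1(1) low(2) \<tau>\<mu>(1) low(1) \<tau>\<mu>(2) sg cl])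
           (use AB in auto)
    qed
    show "(\<lambda>K. g K \<theta>) \<longlonglongrightarrow> 0"
      unfolding g_def
      by (intro tendsto_mult_right_zero dirichlet_mult_int_diff_tendsto_0 pos \<tau>\<mu> \<sigma> sg)
  qed auto
  \<comment> \<open>By periodicity the error integrand is \<open>g K\<close> minus \<open>h\<close>
    minus the kernel times \<open>stair B \<theta> - q\<close>. The last two integrate to 0, the
    first of them by oddness in \<open>\<sigma>\<close>.\<close>
  moreover have "integral {c..d} (arc_error A B K) = integral {c..d} (g K)" for K
  proof -
    define h where "h \<theta> = A * cos \<theta> * (dirichlet K (\<sigma> \<theta>) * dirichlet_int K (l * \<sigma> \<theta>))" for \<theta>
    have "((\<lambda>\<theta>. (A * cos \<theta>) *\<^sub>R (dirichlet K (\<sigma> \<theta>) * dirichlet_int K (l * \<sigma> \<theta>)))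
        has_integral integral {\<sigma> c..\<sigma> d} (\<lambda>w. dirichlet K w * dirichlet_int K (l * w))) {c..d}"
    proof (rule has_integral_substitution)
      show "\<sigma> ` {c..d} \<subseteq> {-s..s}"
        using \<sigma>_le by (auto simp: abs_le_iff minus_le_iff)
      show "\<sigma> c \<le> \<sigma> d" using s by (simp add: \<sigma>_def sin_cd)
      show "continuous_on {-s..s} (\<lambda>w. dirichlet K w * dirichlet_int K (l * w))"
        by (intro continuous_intros)
      show "(\<sigma> has_real_derivative A * cos \<theta>) (at \<theta> within {c..d})" for \<theta>
        unfolding \<sigma>_def by (auto intro!: derivative_eq_intros)
    qed (use cd in simp)
    then have "(h has_integral integral {\<sigma> c..\<sigma> d} (\<lambda>w. dirichlet K w * dirichlet_int K (l * w))) {c..d}"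
      by (simp add: h_def[abs_def])
    moreover have "integral {\<sigma> c..\<sigma> d} (\<lambda>w. dirichlet K w * dirichlet_int K (l * w)) = 0"
      unfolding \<sigma>_def sin_cd using integral_odd_eq_0[of "\<lambda>w. dirichlet K w * dirichlet_int K (l * w)" s] by simp
    ultimately have h: "(h has_integral 0) {c..d}" by simp
    \<comment> \<open>The staircase jumps from \<open>q + 1/2\<close> to \<open>q - 1/2\<close> at
      \<open>\<theta>0\<close>, so \<open>stair B \<theta> - q\<close> is 1/2 before and -1/2 after.
      As the interval is symmetric in \<open>\<sigma>\<close>, the two halves contribute opposite
      multiples of \<open>dirichlet_int K s\<close>.\<close>
    have left: "((\<lambda>\<theta>. dirichlet_arc A K \<theta> * (stair B \<theta> - q)) has_integral dirichlet_int K s / 2) {c..\<theta>0}"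
    proof (rule has_integral_spike)
      show "negligible {\<theta>0}" by simp
      have "dirichlet_int K (A * sin c) = p - dirichlet_int K s"
        unfolding sin_cd using dirichlet_int_add_int[of K "-s" p] by simp
      then show "((\<lambda>\<theta>. dirichlet_arc A K \<theta> * (1 / 2)) has_integral dirichlet_int K s / 2) {c..\<theta>0}"
        using has_integral_mult_left[OF dirichlet_arc_has_integral[of c \<theta>0 A K], of "1/2"] cd \<theta>0 by simp
      fix \<theta> assume \<theta>: "\<theta> \<in> {c..\<theta>0} - {\<theta>0}"
      have "sin \<theta> \<le> sin \<theta>0" using \<theta> \<theta>0 cd by (intro sin_monotone_2pi_le) auto
      then have "\<sigma> \<theta> \<le> 0" using AB \<theta>0 by (simp add: \<sigma>_def flip: \<theta>0(2))
      then have "\<tau> \<theta> \<le> 0" using geom(3)[of \<theta>] \<theta> cd by (auto simp: sgn_if split: if_splits)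
      moreover have "\<bar>\<tau> \<theta>\<bar> \<le> 1 / 2" using \<tau>_le[of \<theta>] \<theta> cd by simp
      ultimately have "\<lfloor>B * cos \<theta>\<rfloor> = q"
        using s by (auto simp: floor_eq_iff \<tau>_def)
      then show "dirichlet_arc A K \<theta> * (stair B \<theta> - q) = dirichlet_arc A K \<theta> * (1 / 2)"
        by (simp add: stair_def)
    qed
    have right: "((\<lambda>\<theta>. dirichlet_arc A K \<theta> * (stair B \<theta> - q)) has_integral - dirichlet_int K s / 2) {\<theta>0..d}"
    proof (rule has_integral_spike)
      show "negligible {\<theta>0}" by simp
      have "dirichlet_int K (A * sin d) = p + dirichlet_int K s"
        unfolding sin_cd using dirichlet_int_add_int[of K "s" p] by (simp add: add.commute)
      then show "((\<lambda>\<theta>. dirichlet_arc A K \<theta> * (- 1 / 2)) has_integral - dirichlet_int K s / 2) {\<theta>0..d}"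
        using has_integral_mult_left[OF dirichlet_arc_has_integral[of \<theta>0 d A K], of "-1/2"] cd \<theta>0 by simp
      fix \<theta> assume \<theta>: "\<theta> \<in> {\<theta>0..d} - {\<theta>0}"
      have "sin \<theta>0 < sin \<theta>" using \<theta> \<theta>0 cd by (intro sin_monotone_2pi) auto
      then have "0 < \<sigma> \<theta>" using AB \<theta>0 by (simp add: \<sigma>_def flip: \<theta>0(2))
      then have "0 < \<tau> \<theta>" using geom(3)[of \<theta>] \<theta> cd by (auto simp: sgn_if split: if_splits)
      moreover have "\<bar>\<tau> \<theta>\<bar> \<le> 1 / 2" using \<tau>_le[of \<theta>] \<theta> cd by simp
      ultimately have "\<lfloor>B * cos \<theta>\<rfloor> = q - 1"
        using s by (auto simp: floor_eq_iff \<tau>_def)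
      then show "dirichlet_arc A K \<theta> * (stair B \<theta> - q) = dirichlet_arc A K \<theta> * (- 1 / 2)"
        by (simp add: stair_def)
    qed
    have st: "((\<lambda>\<theta>. dirichlet_arc A K \<theta> * (stair B \<theta> - q)) has_integral 0) {c..d}"
      using has_integral_combine[OF _ _ left right] cd by simp
    have "(arc_error A B K has_integral integral {c..d} (g K) - 0 - 0) {c..d}"
    proof (rule has_integral_eq[OF _ has_integral_diff[OF has_integral_diff[OF integrable_integral h] st]])
      show "g K integrable_on {c..d}"
        unfolding g_def \<sigma>_def \<tau>_def by (intro integrable_continuous_real continuous_intros)
      show "g K \<theta> - h \<theta> - dirichlet_arc A K \<theta> * (stair B \<theta> - q) = arc_error A B K \<theta>" for \<theta>
        by (simp add: g_def h_def arc_error_def dirichlet_arc_def dir int algebra_simps)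
    qed
    then show ?thesis by (simp add: integral_unique)
  qed
  ultimately show ?thesis using that[OF cd] by simp
qed

section \<open>The limit of the integral over the whole quarter arc\<close>

text \<open>A lattice point at \<open>\<theta> = pi / 2\<close> is harmless and one at
  \<open>\<theta> = 0\<close> is excluded by \<open>B \<notin> \<int>\<close>. By uniqueness there
  is at most one other; a neighbourhood of it is treated separately and the remaining two pieces
  contain none, apart from possibly \<open>pi / 2\<close>.\<close>

lemma arc_error_quarter_tendsto_0:
  assumes AB: "A > 0" "B > 0" and B: "B \<notin> \<int>"
    and unique: "\<And>(p::nat) (q::nat) (p'::nat) (q'::nat). (p / A)\<^sup>2 + (q / B)\<^sup>2 = 1 \<Longrightarrow> (p' / A)\<^sup>2 + (q' / B)\<^sup>2 = 1 \<Longrightarrow> p = p' \<and> q = q'"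
  shows "(\<lambda>K. integral {0..pi/2} (arc_error A B K)) \<longlonglongrightarrow> 0"
proof (cases "\<exists>\<theta> \<in> {0..pi/2}. A * sin \<theta> \<in> \<int> \<and> B * cos \<theta> \<in> \<int> \<and> \<theta> \<noteq> pi / 2")
  case False
  then show ?thesis
    by (intro arc_error_tendsto_0[OF AB]) auto
next
  case True
  then obtain \<theta>0 where \<theta>0: "\<theta>0 \<in> {0..pi/2}" "A * sin \<theta>0 \<in> \<int>" "B * cos \<theta>0 \<in> \<int>" "\<theta>0 \<noteq> pi / 2"
    by blast
  have nat: "\<exists>(p::nat) (q::nat). A * sin \<theta> = p \<and> B * cos \<theta> = q \<and> (p / A)\<^sup>2 + (q / B)\<^sup>2 = 1"
    if \<theta>: "\<theta> \<in> {0..pi/2}" "A * sin \<theta> \<in> \<int>" "B * cos \<theta> \<in> \<int>" for \<theta>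
  proof -
    have "0 \<le> A * sin \<theta>" "0 \<le> B * cos \<theta>"
      using \<theta> AB by (auto intro!: mult_nonneg_nonneg sin_ge_zero cos_ge_zero)
    then obtain p q :: nat where pq: "A * sin \<theta> = p" "B * cos \<theta> = q"
      using \<theta> by (metis Ints_cases of_int_0_le_iff of_int_of_nat_eq zero_le_imp_eq_int)
    then have "p / A = sin \<theta>" "q / B = cos \<theta>" using AB by (auto simp: field_simps)
    then show ?thesis using pq by auto
  qed
  obtain p q :: nat where pq: "A * sin \<theta>0 = p" "B * cos \<theta>0 = q" "(p / A)\<^sup>2 + (q / B)\<^sup>2 = 1"
    using nat \<theta>0 by blast
  have only: "\<theta> = \<theta>0" if \<theta>: "\<theta> \<in> {0..pi/2}" "A * sin \<theta> \<in> \<int>" "B * cos \<theta> \<in> \<int>" for \<theta>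
  proof -
    obtain p' q' :: nat where pq': "A * sin \<theta> = p'" "B * cos \<theta> = q'" "(p' / A)\<^sup>2 + (q' / B)\<^sup>2 = 1"
      using nat \<theta> by blast
    then have "B * cos \<theta> = B * cos \<theta>0" using unique[OF pq(3) pq'(3)] pq by simp
    then have "cos \<theta> = cos \<theta>0" using AB by simp
    then show ?thesis by (rule cos_inj_pi[rotated 4]) (use \<theta> \<theta>0 in auto)
  qed
  have "0 < \<theta>0"
  proof (rule ccontr)
    assume "\<not> 0 < \<theta>0"
    then have "\<theta>0 = 0" using \<theta>0 by simp
    then show False using \<theta>0 B by simp
  qed
  then have "sin \<theta>0 > 0" "cos \<theta>0 > 0"
    using \<theta>0 by (auto intro!: sin_gt_zero cos_gt_zero)
  then have "real p > 0" "real q > 0"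
    using AB by (auto simp flip: pq)
  then have "int p > 0" "int q > 0" by auto
  moreover have "A * sin \<theta>0 = of_int (int p)" "B * cos \<theta>0 = of_int (int q)"
    using pq by auto
  ultimately obtain c d where cd: "0 \<le> c" "c < \<theta>0" "\<theta>0 < d" "d \<le> pi / 2"
    and mid: "(\<lambda>K. integral {c..d} (arc_error A B K)) \<longlonglongrightarrow> 0"
    using arc_error_near_lattice_point[OF AB _ _ \<theta>0(1)] by metis
  have "(\<lambda>K. integral {0..c} (arc_error A B K) + integral {c..d} (arc_error A B K)
      + integral {d..pi/2} (arc_error A B K)) \<longlonglongrightarrow> 0 + 0 + 0"
  proof (intro tendsto_add mid arc_error_tendsto_0[OF AB])
    show "\<theta> = pi / 2" if "\<theta> \<in> {0..c}" "A * sin \<theta> \<in> \<int>" "B * cos \<theta> \<in> \<int>" for \<theta>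
      using only[of \<theta>] that cd by auto
    show "\<theta> = pi / 2" if "\<theta> \<in> {d..pi/2}" "A * sin \<theta> \<in> \<int>" "B * cos \<theta> \<in> \<int>" for \<theta>
      using only[of \<theta>] that cd by auto
  qed (use cd in auto)
  also have "(\<lambda>K. integral {0..c} (arc_error A B K) + integral {c..d} (arc_error A B K)
      + integral {d..pi/2} (arc_error A B K)) = (\<lambda>K. integral {0..pi/2} (arc_error A B K))"
  proof
    fix K
    have "integral {0..d} (arc_error A B K) = integral {0..c} (arc_error A B K) + integral {c..d} (arc_error A B K)"
      using cd AB by (intro Henstock_Kurzweil_Integration.integral_combine[symmetric] arc_error_integrable) auto
    moreover have "integral {0..pi/2} (arc_error A B K) = integral {0..d} (arc_error A B K) + integral {d..pi/2} (arc_error A B K)"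
      using cd AB by (intro Henstock_Kurzweil_Integration.integral_combine[symmetric] arc_error_integrable) auto
    ultimately show "integral {0..c} (arc_error A B K) + integral {c..d} (arc_error A B K)
      + integral {d..pi/2} (arc_error A B K) = integral {0..pi/2} (arc_error A B K)" by simp
  qed
  finally show ?thesis by simp
qed

text \<open>After the split into error and staircase, the upper limit \<open>arccos (q / B)\<close>
  turns the q-th piece into the primitive at the half-chord
  \<open>A * sqrt (1 - (q / B)\<^sup>2)\<close>; the 1/2 in \<open>stair\<close> yields the term
  with weight 1/2 for the row q = 0.\<close>

lemma dirichlet_quarter_ellipse_tendsto:
  assumes AB: "A > 0" "B > 0" and B: "B \<notin> \<int>"
    and unique: "\<And>(p::nat) (q::nat) (p'::nat) (q'::nat). (p / A)\<^sup>2 + (q / B)\<^sup>2 = 1 \<Longrightarrow> (p' / A)\<^sup>2 + (q' / B)\<^sup>2 = 1 \<Longrightarrow> p = p' \<and> q = q'"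
  shows "(\<lambda>K. integral {0..pi/2} (\<lambda>\<theta>. dirichlet_arc A K \<theta> * dirichlet_int K (B * cos \<theta>)))
    \<longlonglongrightarrow> mid_floor A / 2 + (\<Sum>q = 1..nat \<lfloor>B\<rfloor>. mid_floor (A * sqrt (1 - (q / B)\<^sup>2)))"
proof -
  have eq: "integral {0..pi/2} (\<lambda>\<theta>. dirichlet_arc A K \<theta> * dirichlet_int K (B * cos \<theta>))
      = integral {0..pi/2} (arc_error A B K)
        + (dirichlet_int K A / 2 + (\<Sum>q = 1..nat \<lfloor>B\<rfloor>. dirichlet_int K (A * sqrt (1 - (q / B)\<^sup>2))))" for K
  proof -
    have "integral {0..arccos (q / B)} (dirichlet_arc A K) = dirichlet_int K (A * sqrt (1 - (q / B)\<^sup>2))"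
      if "q \<in> {1..nat \<lfloor>B\<rfloor>}" for q
    proof -
      have "real q \<le> B"
        using that by (intro order.trans[OF of_nat_mono of_nat_floor]) (use AB in auto)
      then have "-1 \<le> q / B" "q / B \<le> 1" using AB by (auto intro: order.trans[of _ 0])
      then show ?thesis
        using dirichlet_arc_has_integral[OF arccos_lbound, of "q / B" A K]
        by (simp add: integral_unique sin_arccos)
    qed
    moreover have "integral {0..pi/2} (dirichlet_arc A K) = dirichlet_int K A"
      using dirichlet_arc_has_integral[of 0 "pi/2" A K] by (simp add: integral_unique)
    ultimately have "((\<lambda>\<theta>. dirichlet_arc A K \<theta> * stair B \<theta>) has_integral
        (dirichlet_int K A / 2 + (\<Sum>q = 1..nat \<lfloor>B\<rfloor>. dirichlet_int K (A * sqrt (1 - (q / B)\<^sup>2))))) {0..pi/2}"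
      using stair_has_integral[OF continuous_on_dirichlet_arc AB(2), of A K] by simp
    from has_integral_add[OF integrable_integral[OF arc_error_integrable[OF AB(2) order.refl order.refl]] this]
    have "((\<lambda>\<theta>. arc_error A B K \<theta> + dirichlet_arc A K \<theta> * stair B \<theta>) has_integral
        (integral {0..pi/2} (arc_error A B K)
        + (dirichlet_int K A / 2 + (\<Sum>q = 1..nat \<lfloor>B\<rfloor>. dirichlet_int K (A * sqrt (1 - (q / B)\<^sup>2)))))) {0..pi/2}" .
    then show ?thesis
      by (intro integral_unique) (simp add: arc_error_def algebra_simps)
  qed
  have "(\<lambda>K. integral {0..pi/2} (\<lambda>\<theta>. dirichlet_arc A K \<theta> * dirichlet_int K (B * cos \<theta>)))
    \<longlonglongrightarrow> 0 + (mid_floor A / 2 + (\<Sum>q = 1..nat \<lfloor>B\<rfloor>. mid_floor (A * sqrt (1 - (q / B)\<^sup>2))))"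
    unfolding eq
    by (intro tendsto_add tendsto_divide tendsto_sum tendsto_const dirichlet_int_tendsto
        arc_error_quarter_tendsto_0[OF AB B unique]) auto
  then show ?thesis by simp
qed

subsection \<open>Integral representations of the Bessel function\<close>

text \<open>Wallis integrals. The recurrence comes from differentiating
  \<open>cos \<theta> ^ (2k + 1) * sin \<theta>\<close>, which vanishes at both ends.\<close>

lemma has_integral_cos_power_even:
  "((\<lambda>\<theta>. cos \<theta> ^ (2 * k)) has_integral pi / 2 * fact (2 * k) / (4 ^ k * (fact k)\<^sup>2)) {0..pi/2}"
proof (induction k)
  case 0
  show ?case using has_integral_const_real[of "1::real" 0 "pi/2"] by simp
next
  case (Suc k)
  have "((\<lambda>\<theta>. (2 * k + 2) * cos \<theta> ^ (2 * Suc k) - (2 * k + 1) * cos \<theta> ^ (2 * k)) has_integral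
      cos (pi/2) ^ (2 * k + 1) * sin (pi/2) - cos 0 ^ (2 * k + 1) * sin 0) {0..pi/2}"
  proof (rule fundamental_theorem_of_calculus)
    fix \<theta> :: real
    have "((\<lambda>\<theta>. cos \<theta> ^ (2 * k + 1) * sin \<theta>) has_real_derivative
        cos \<theta> ^ (2 * k + 1) * cos \<theta> - (2 * k + 1) * cos \<theta> ^ (2 * k) * (sin \<theta>)\<^sup>2) (at \<theta> within {0..pi/2})"
      by (rule derivative_eq_intros refl | simp add: power2_eq_square algebra_simps del: power_Suc)+
    also have "cos \<theta> ^ (2 * k + 1) * cos \<theta> - (2 * k + 1) * cos \<theta> ^ (2 * k) * (sin \<theta>)\<^sup>2
        = (2 * k + 2) * cos \<theta> ^ (2 * Suc k) - (2 * k + 1) * cos \<theta> ^ (2 * k)"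
      unfolding sin_squared_eq by (simp add: algebra_simps power2_eq_square)
    finally show "((\<lambda>\<theta>. cos \<theta> ^ (2 * k + 1) * sin \<theta>) has_vector_derivative
        (2 * k + 2) * cos \<theta> ^ (2 * Suc k) - (2 * k + 1) * cos \<theta> ^ (2 * k)) (at \<theta> within {0..pi/2})"
      by (simp add: has_real_derivative_iff_has_vector_derivative)
  qed simp
  from has_integral_add[OF this has_integral_mult_right[OF Suc, of "2 * k + 1"]]
  have "((\<lambda>\<theta>. (2 * k + 2) * cos \<theta> ^ (2 * Suc k)) has_integral
      (2 * k + 1) * (pi / 2 * fact (2 * k) / (4 ^ k * (fact k)\<^sup>2))) {0..pi/2}"
    by simp
  from has_integral_mult_right[OF this, of "1 / (2 * k + 2)"]
  have "((\<lambda>\<theta>. cos \<theta> ^ (2 * Suc k)) has_integral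
      1 / (2 * k + 2) * ((2 * k + 1) * (pi / 2 * fact (2 * k) / (4 ^ k * (fact k)\<^sup>2)))) {0..pi/2}"
    unfolding mult.assoc[symmetric] by (simp del: power_Suc)
  also have "1 / (2 * k + 2) * ((2 * k + 1) * (pi / 2 * fact (2 * k) / (4 ^ k * (fact k)\<^sup>2)))
      = pi / 2 * fact (2 * Suc k) / (4 ^ Suc k * (fact (Suc k))\<^sup>2)"
    by (simp add: divide_simps power2_eq_square) (simp add: algebra_simps)
  finally show ?case .
qed

text \<open>Poisson's integral: the sine series is integrated term by term, where the Wallis value
  turns the sine coefficient \<open>c k\<close> into the Bessel term \<open>a k\<close>. The M-test
  with the series of \<open>c k\<close> justifies the exchange.\<close>

lemma bessel_J_1_has_integral_cos:
  "((\<lambda>\<theta>. cos \<theta> * sin (z * cos \<theta>)) has_integral pi / 2 * bessel_J 1 z) {0..pi/2}"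
proof -
  define c where "c k = (-1) ^ k / fact (2 * k + 1) * z ^ (2 * k + 1)" for k :: nat
  define f where "f n \<theta> = (\<Sum>k<n. c k * cos \<theta> ^ (2 * Suc k))" for n \<theta>
  define a where "a k = (-1) ^ k / (fact k * fact (k + 1)) * (z / 2) ^ (2 * k + 1)" for k :: nat
  have f_int: "(f n has_integral (\<Sum>k<n. pi / 2 * a k)) {0..pi/2}" for n
  proof -
    have "(f n has_integral (\<Sum>k<n. c k * (pi / 2 * fact (2 * Suc k) / (4 ^ Suc k * (fact (Suc k))\<^sup>2)))) {0..pi/2}"
      unfolding f_def by (intro has_integral_sum has_integral_mult_right has_integral_cos_power_even) auto
    moreover have "c k * (pi / 2 * fact (2 * Suc k) / (4 ^ Suc k * (fact (Suc k))\<^sup>2)) = pi / 2 * a k" for k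
    proof -
      have "fact (2 * Suc k) = (2 * real k + 2) * fact (2 * k + 1)" by (simp add: algebra_simps)
      moreover have "(2::real) ^ (2 * k) = 4 ^ k" by (simp add: power_mult)
      ultimately show ?thesis
        by (simp add: a_def c_def power_divide power2_eq_square divide_simps del: fact_Suc)
           (simp add: fact_Suc algebra_simps)
    qed
    ultimately show ?thesis by (simp only:)
  qed
  have "uniform_limit {0..pi/2} f (\<lambda>\<theta>. \<Sum>k. c k * cos \<theta> ^ (2 * Suc k)) sequentially"
    unfolding f_def
  proof (rule Weierstrass_m_test)
    show "norm (c k * cos \<theta> ^ (2 * Suc k)) \<le> norm (c k)" for k \<theta>
    proof -
      have "\<bar>cos \<theta> ^ (2 * Suc k)\<bar> \<le> 1"
        unfolding power_abs by (intro power_le_one) auto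
      then show ?thesis unfolding norm_mult by (intro mult_left_le) auto
    qed
    have "summable (\<lambda>n. norm (z ^ n /\<^sub>R fact n))" by (rule summable_norm_exp)
    then have "summable (\<lambda>k. norm (z ^ (2 * k + 1) /\<^sub>R fact (2 * k + 1)))"
      by (rule summable_reindex[where g = "\<lambda>k. 2 * k + 1", unfolded comp_def]) (auto intro: injI)
    moreover have "norm (z ^ (2 * k + 1) /\<^sub>R fact (2 * k + 1)) = norm (c k)" for k
      by (simp add: c_def abs_mult power_abs divide_inverse del: power_Suc fact_Suc)
    ultimately show "summable (\<lambda>k. norm (c k))" by simp
  qed
  moreover have "(\<Sum>k. c k * cos \<theta> ^ (2 * Suc k)) = cos \<theta> * sin (z * cos \<theta>)" for \<theta>
  proof -
    have "(\<lambda>k. cos \<theta> * ((-1) ^ k / fact (2 * k + 1) * (z * cos \<theta>) ^ (2 * k + 1))) sums (cos \<theta> * sin (z * cos \<theta>))"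
      by (intro sums_mult sin_paired)
    then have "(\<lambda>k. c k * cos \<theta> ^ (2 * Suc k)) sums (cos \<theta> * sin (z * cos \<theta>))"
      by (simp add: c_def power_mult_distrib mult_ac)
    then show ?thesis by (simp add: sums_iff)
  qed
  ultimately have "uniform_limit {0..pi/2} f (\<lambda>\<theta>. cos \<theta> * sin (z * cos \<theta>)) sequentially"
    by simp
  then obtain I J where IJ: "\<And>n. (f n has_integral I n) {0..pi/2}"
      "((\<lambda>\<theta>. cos \<theta> * sin (z * cos \<theta>)) has_integral J) {0..pi/2}" "I \<longlonglongrightarrow> J"
    by (rule uniform_limit_integral)
       (auto simp: f_def intro!: continuous_intros)
  have "I = (\<lambda>n. \<Sum>k<n. pi / 2 * a k)"
    by (rule ext) (rule has_integral_unique[OF IJ(1) f_int])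
  then have "(\<lambda>k. pi / 2 * a k) sums J"
    using IJ(3) unfolding sums_def by (simp only:)
  then have "(\<lambda>k. 2 / pi * (pi / 2 * a k)) sums (2 / pi * J)" by (rule sums_mult)
  then have "a sums (2 / pi * J)" by simp
  then have "J = pi / 2 * bessel_J 1 z"
    by (simp add: bessel_J_def a_def[abs_def] sums_iff)
  then show ?thesis using IJ(2) by (simp only:)
qed

lemma integral_even:
  fixes f :: "real \<Rightarrow> real"
  assumes cont: "continuous_on UNIV f" and even: "\<And>x. f (- x) = f x" and "0 \<le> a"
  shows "integral {-a..a} f = 2 * integral {0..a} f"
proof -
  have "integral {-a..0} f + integral {0..a} f = integral {-a..a} f"
    using assms by (intro Henstock_Kurzweil_Integration.integral_combine integrable_continuous_real continuous_on_subset[OF cont]) auto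
  then show ?thesis
    using Henstock_Kurzweil_Integration.integral_reflect_real[of a 0 f] even by simp
qed

lemma integral_periodic_shift:
  fixes f :: "real \<Rightarrow> real"
  assumes cont: "continuous_on UNIV f" and per: "\<And>x. f (x + p) = f x" and "0 \<le> c" "0 \<le> p"
  shows "integral {a + c..a + p + c} f = integral {a..a + p} f"
proof -
  have int: "f integrable_on {u..v}" for u v
    by (intro integrable_continuous_real continuous_on_subset[OF cont]) auto
  have "integral {a..a + p} f + integral {a + p..a + p + c} f = integral {a..a + p + c} f"
    "integral {a..a + c} f + integral {a + c..a + p + c} f = integral {a..a + p + c} f"
    using assms by (auto intro!: Henstock_Kurzweil_Integration.integral_combine int)
  moreover have "integral {a + p..a + c + p} f = integral {a..a + c} f"
    using integral_shift[of a p "a + c" f] per continuous_on_subset[OF cont] by (simp add: comp_def)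
  ultimately show ?thesis by (simp add: add_ac)
qed

text \<open>The integrand over the half period is the rotation by \<open>arccos (\<beta> / z)\<close> of the one for \<open>\<alpha> = 0\<close>.\<close>

lemma bessel_J_1_has_integral_rotated:
  assumes ab: "\<alpha> \<ge> 0" "\<beta> \<ge> 0" and z: "z = sqrt (\<alpha>\<^sup>2 + \<beta>\<^sup>2)" "z > 0"
  shows "((\<lambda>\<theta>. cos \<theta> * cos (\<alpha> * sin \<theta>) * sin (\<beta> * cos \<theta>)) has_integral
      pi / 2 * (\<beta> / z * bessel_J 1 z)) {0..pi/2}"
proof -
  define \<phi> where "\<phi> = arccos (\<beta> / z)"
  have "\<beta> \<le> z" using ab unfolding z(1) by (simp add: real_le_rsqrt)
  then have bz: "0 \<le> \<beta> / z" "\<beta> / z \<le> 1" "-1 \<le> \<beta> / z"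
    using ab z(2) by (auto intro: order.trans[of _ 0])
  have \<phi>: "0 \<le> \<phi>" "z * cos \<phi> = \<beta>" "z * sin \<phi> = \<alpha>"
  proof -
    show "0 \<le> \<phi>" using bz by (auto simp: \<phi>_def intro: arccos_lbound)
    show "z * cos \<phi> = \<beta>" using bz z by (simp add: \<phi>_def cos_arccos)
    have "sin \<phi> = sqrt (1 - (\<beta> / z)\<^sup>2)" using bz by (simp add: \<phi>_def sin_arccos)
    also have "1 - (\<beta> / z)\<^sup>2 = (\<alpha> / z)\<^sup>2"
    proof -
      have "z\<^sup>2 = \<alpha>\<^sup>2 + \<beta>\<^sup>2" unfolding z(1) by simp
      moreover have "1 - (\<beta> / z)\<^sup>2 = (z\<^sup>2 - \<beta>\<^sup>2) / z\<^sup>2"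
        using z(2) by (simp add: power_divide diff_divide_distrib)
      ultimately show ?thesis by (simp add: power_divide)
    qed
    finally show "z * sin \<phi> = \<alpha>" using ab z(2) by simp
  qed
  \<comment> \<open>\<open>G\<close> is the odd \<open>O1\<close> plus the even \<open>H\<close>, so
    its integral over the symmetric half period is twice that of \<open>H\<close>. Both factors of
    \<open>G\<close> change sign under a shift by pi, so \<open>G\<close> has period pi and may be
    shifted by \<open>\<phi>\<close>; the phase becomes \<open>z * cos \<theta>\<close> and only the
    even part \<open>cos \<phi> * I\<close> survives.\<close>
  define G where "G \<theta> = cos \<theta> * sin (\<alpha> * sin \<theta> + \<beta> * cos \<theta>)" for \<theta>
  define H where "H \<theta> = cos \<theta> * cos (\<alpha> * sin \<theta>) * sin (\<beta> * cos \<theta>)" for \<theta>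
  define O1 where "O1 \<theta> = cos \<theta> * sin (\<alpha> * sin \<theta>) * cos (\<beta> * cos \<theta>)" for \<theta>
  define O2 where "O2 \<theta> = sin \<theta> * sin (z * cos \<theta>)" for \<theta>
  define I where "I \<theta> = cos \<theta> * sin (z * cos \<theta>)" for \<theta>
  have cont: "continuous_on S G" "continuous_on S H" "continuous_on S O1" "continuous_on S O2" "continuous_on S I" for S
    unfolding G_def H_def O1_def O2_def I_def by (intro continuous_intros)+
  note int = integrable_continuous_real[OF cont(1)] integrable_continuous_real[OF cont(2)]
    integrable_continuous_real[OF cont(3)] integrable_continuous_real[OF cont(4)] integrable_continuous_real[OF cont(5)]
  have "integral {-(pi/2)..pi/2} G = integral {-(pi/2)..pi/2} (\<lambda>\<theta>. O1 \<theta> + H \<theta>)"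
    by (simp add: G_def[abs_def] O1_def H_def sin_add algebra_simps)
  also have "\<dots> = integral {-(pi/2)..pi/2} O1 + integral {-(pi/2)..pi/2} H"
    by (intro Henstock_Kurzweil_Integration.integral_add int)
  also have "integral {-(pi/2)..pi/2} O1 = 0"
    by (rule integral_odd_eq_0) (simp add: O1_def)
  also have "integral {-(pi/2)..pi/2} H = 2 * integral {0..pi/2} H"
    by (rule integral_even[OF cont(2)]) (simp_all add: H_def)
  finally have 1: "integral {-(pi/2)..pi/2} G = 2 * integral {0..pi/2} H" by simp
  have per: "G (\<theta> + pi) = G \<theta>" for \<theta>
  proof -
    have "\<alpha> * sin (\<theta> + pi) + \<beta> * cos (\<theta> + pi) = - (\<alpha> * sin \<theta> + \<beta> * cos \<theta>)" by simp
    then show ?thesis unfolding G_def by (simp only: sin_minus cos_periodic_pi minus_mult_minus)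
  qed
  have "integral {-(pi/2)..pi/2} G = integral {-(pi/2) + \<phi>..-(pi/2) + pi + \<phi>} G"
    by (subst integral_periodic_shift[OF cont(1) per]) (use \<phi> in auto)
  also have "\<dots> = integral {-(pi/2)..pi/2} (\<lambda>\<theta>. G (\<theta> + \<phi>))"
    using integral_shift[of "-(pi/2)" \<phi> "pi/2" G] cont(1) by (simp add: comp_def)
  also have "\<dots> = integral {-(pi/2)..pi/2} (\<lambda>\<theta>. cos \<phi> * I \<theta> - sin \<phi> * O2 \<theta>)"
  proof -
    have "\<alpha> * sin (\<theta> + \<phi>) + \<beta> * cos (\<theta> + \<phi>) = z * cos \<theta>" for \<theta>
    proof -
      have "\<alpha> * sin (\<theta> + \<phi>) + \<beta> * cos (\<theta> + \<phi>) = z * (cos (\<theta> + \<phi>) * cos \<phi> + sin (\<theta> + \<phi>) * sin \<phi>)"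
        unfolding \<phi>(2,3)[symmetric] by (simp add: algebra_simps)
      then show ?thesis by (simp flip: cos_diff)
    qed
    then show ?thesis
      by (simp add: G_def I_def O2_def cos_add algebra_simps)
  qed
  also have "\<dots> = cos \<phi> * integral {-(pi/2)..pi/2} I - sin \<phi> * integral {-(pi/2)..pi/2} O2"
    by (subst Henstock_Kurzweil_Integration.integral_diff)
       (auto intro!: integrable_on_mult_right int)
  also have "integral {-(pi/2)..pi/2} O2 = 0"
    by (rule integral_odd_eq_0) (simp add: O2_def)
  also have "integral {-(pi/2)..pi/2} I = 2 * integral {0..pi/2} I"
    by (rule integral_even[OF cont(5)]) (simp_all add: I_def)
  also have "integral {0..pi/2} I = pi / 2 * bessel_J 1 z"
    unfolding I_def by (rule integral_unique[OF bessel_J_1_has_integral_cos])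
  finally have "integral {0..pi/2} H = cos \<phi> * (pi / 2 * bessel_J 1 z)"
    using 1 by simp
  also have "cos \<phi> = \<beta> / z" using \<phi>(2) z(2) by (simp add: eq_divide_eq mult.commute)
  finally have "(H has_integral pi / 2 * (\<beta> / z * bessel_J 1 z)) {0..pi/2}"
    using integrable_integral[OF int(2)[of 0 "pi/2"]] by (simp add: mult_ac)
  then show ?thesis by (simp add: H_def[abs_def])
qed

lemma bessel_J_1_has_integral_sin:
  "((\<lambda>\<theta>. sin \<theta> * sin (z * sin \<theta>)) has_integral pi / 2 * bessel_J 1 z) {0..pi/2}"
proof -
  \<comment> \<open>The substitution \<open>pi/2 - \<theta>\<close> is decreasing, so the first of
    the two oriented integrals is over an empty interval and the second carries the value with a
    minus sign.\<close>
  have "((\<lambda>\<theta>. (-1) *\<^sub>R (cos (pi/2 - \<theta>) * sin (z * cos (pi/2 - \<theta>)))) has_integral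
      integral {pi/2 - 0..pi/2 - pi/2} (\<lambda>\<theta>. cos \<theta> * sin (z * cos \<theta>)) -
      integral {pi/2 - pi/2..pi/2 - 0} (\<lambda>\<theta>. cos \<theta> * sin (z * cos \<theta>))) {0..pi/2}"
    by (rule has_integral_substitution_general[where s = "{}" and c = 0 and d = "pi/2"])
       (auto intro!: continuous_intros derivative_eq_intros)
  from has_integral_neg[OF this] show ?thesis
    using integral_unique[OF bessel_J_1_has_integral_cos, of z] by (simp add: cos_diff)
qed

text \<open>Integration by parts against the previous integral, with
  \<open>cos \<theta> * sin (\<alpha> * sin \<theta>)\<close> as the boundary term that vanishes at
  both ends.\<close>

lemma bessel_J_1_has_integral_cos2:
  assumes "\<alpha> > 0"
  shows "((\<lambda>\<theta>. (cos \<theta>)\<^sup>2 * cos (\<alpha> * sin \<theta>)) has_integral pi / 2 * (bessel_J 1 \<alpha> / \<alpha>)) {0..pi/2}"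
proof -
  have "((\<lambda>\<theta>. \<alpha> * ((cos \<theta>)\<^sup>2 * cos (\<alpha> * sin \<theta>)) - sin \<theta> * sin (\<alpha> * sin \<theta>)) has_integral
      cos (pi/2) * sin (\<alpha> * sin (pi/2)) - cos 0 * sin (\<alpha> * sin 0)) {0..pi/2}"
    by (rule fundamental_theorem_of_calculus)
       (auto simp: power2_eq_square simp flip: has_real_derivative_iff_has_vector_derivative
         intro!: derivative_eq_intros)
  from has_integral_add[OF this bessel_J_1_has_integral_sin[of \<alpha>]]
  have "((\<lambda>\<theta>. \<alpha> * ((cos \<theta>)\<^sup>2 * cos (\<alpha> * sin \<theta>))) has_integral pi / 2 * bessel_J 1 \<alpha>) {0..pi/2}"
    by simp
  from has_integral_mult_right[OF this, of "1 / \<alpha>"] show ?thesis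
    using assms by (simp add: mult.commute)
qed

section \<open>Bessel expansion of the arc integral and convergence of the axis sums\<close>

text \<open>Kernel and primitive are multiplied out into four groups: the constant terms give the
  area, the two mixed groups give the axis sums, and the product of the trigonometric sums gives the
  square partial sum.\<close>

lemma dirichlet_quarter_ellipse_has_integral:
  assumes AB: "A > 0" "B > 0"
  shows "((\<lambda>\<theta>. dirichlet_arc A K \<theta> * dirichlet_int K (B * cos \<theta>)) has_integral
     (pi * A * B / 4
      + B / 2 * (\<Sum>m<K. bessel_J 1 (2 * pi * real (Suc m) * A) / real (Suc m))
      + A / 2 * (\<Sum>n<K. bessel_J 1 (2 * pi * real (Suc n) * B) / real (Suc n))
      + A * B * (\<Sum>n<K. \<Sum>m<K. bessel_J 1 (2 * pi * sqrt ((real (Suc n) * B)\<^sup>2 + (real (Suc m) * A)\<^sup>2))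
          / sqrt ((real (Suc n) * B)\<^sup>2 + (real (Suc m) * A)\<^sup>2)))) {0..pi/2}"
proof -
  let ?a = "\<lambda>m. 2 * pi * real (Suc m) * A" and ?b = "\<lambda>n. 2 * pi * real (Suc n) * B"
  let ?R = "\<lambda>n m. sqrt ((real (Suc n) * B)\<^sup>2 + (real (Suc m) * A)\<^sup>2)"
  have eq: "dirichlet_arc A K \<theta> * dirichlet_int K (B * cos \<theta>) =
      A * B * cos \<theta> ^ (2 * 1)
      + (\<Sum>m<K. 2 * A * B * ((cos \<theta>)\<^sup>2 * cos (?a m * sin \<theta>)))
      + (\<Sum>n<K. A / (pi * real (Suc n)) * (cos \<theta> * sin (?b n * cos \<theta>)))
      + (\<Sum>n<K. \<Sum>m<K. 2 * A / (pi * real (Suc n)) * (cos \<theta> * cos (?a m * sin \<theta>) * sin (?b n * cos \<theta>)))" for \<theta>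
  proof -
    define C where "C = (\<Sum>m<K. cos (?a m * sin \<theta>))"
    define S where "S = (\<Sum>n<K. sin (?b n * cos \<theta>) / (pi * real (Suc n)))"
    have "dirichlet_arc A K \<theta> * dirichlet_int K (B * cos \<theta>) = A * cos \<theta> * (1 + 2 * C) * (B * cos \<theta> + S)"
      by (simp add: dirichlet_arc_def dirichlet_def dirichlet_int_def C_def S_def mult.assoc)
    also have "\<dots> = A * B * cos \<theta> ^ (2 * 1) + 2 * A * B * (cos \<theta>)\<^sup>2 * C + A * cos \<theta> * S + 2 * A * cos \<theta> * (S * C)"
      by (simp add: algebra_simps power2_eq_square)
    also have "S * C = (\<Sum>n<K. \<Sum>m<K. sin (?b n * cos \<theta>) / (pi * real (Suc n)) * cos (?a m * sin \<theta>))"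
      unfolding S_def C_def by (rule sum_product)
    finally show ?thesis
      by (simp add: C_def S_def sum_distrib_left mult_ac)
  qed
  have "((\<lambda>\<theta>. dirichlet_arc A K \<theta> * dirichlet_int K (B * cos \<theta>)) has_integral
      A * B * (pi / 2 * fact (2 * 1) / (4 ^ 1 * (fact 1)\<^sup>2))
      + (\<Sum>m<K. 2 * A * B * (pi / 2 * (bessel_J 1 (?a m) / ?a m)))
      + (\<Sum>n<K. A / (pi * real (Suc n)) * (pi / 2 * bessel_J 1 (?b n)))
      + (\<Sum>n<K. \<Sum>m<K. 2 * A / (pi * real (Suc n)) *
          (pi / 2 * (?b n / (2 * pi * ?R n m) * bessel_J 1 (2 * pi * ?R n m))))) {0..pi/2}"
    unfolding eq
  proof (intro has_integral_add has_integral_sum has_integral_mult_right finite_lessThan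
      has_integral_cos_power_even bessel_J_1_has_integral_cos bessel_J_1_has_integral_cos2
      bessel_J_1_has_integral_rotated)
    fix n m
    have pos: "(real (Suc n) * B)\<^sup>2 + (real (Suc m) * A)\<^sup>2 > 0"
      using AB by (intro add_pos_pos) auto
    then show "2 * pi * ?R n m > 0" by simp
    have "(2 * pi * k * A)\<^sup>2 + (2 * pi * l * B)\<^sup>2 = (2 * pi)\<^sup>2 * ((l * B)\<^sup>2 + (k * A)\<^sup>2)" for k l
      by (simp add: power_mult_distrib algebra_simps)
    then have "(?a m)\<^sup>2 + (?b n)\<^sup>2 = (2 * pi)\<^sup>2 * ((real (Suc n) * B)\<^sup>2 + (real (Suc m) * A)\<^sup>2)"
      by blast
    then show "2 * pi * ?R n m = sqrt ((?a m)\<^sup>2 + (?b n)\<^sup>2)"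
      by (simp add: real_sqrt_mult)
  qed (use AB in auto)
  moreover have "2 * A * B * (pi / 2 * (bessel_J 1 (?a m) / ?a m)) = B / 2 * (bessel_J 1 (?a m) / real (Suc m))" for m
  proof -
    have "2 * A * B * (pi / 2 * (j / (2 * pi * k * A))) = B / 2 * (j / k)" if "k > 0" for j k
      using that AB by (simp add: field_simps)
    then show ?thesis by simp
  qed
  moreover have "A / (pi * real (Suc n)) * (pi / 2 * bessel_J 1 (?b n)) = A / 2 * (bessel_J 1 (?b n) / real (Suc n))" for n
  proof -
    have "A / (pi * k) * (pi / 2 * j) = A / 2 * (j / k)" for j k
      by (simp add: field_simps)
    then show ?thesis by simp
  qed
  \<comment> \<open>The factor \<open>real (Suc n)\<close> from the rotated integral cancels the
    denominator of the primitive, which leaves a term depending only on the radius.\<close>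
  moreover have "2 * A / (pi * real (Suc n)) *
          (pi / 2 * (?b n / (2 * pi * ?R n m) * bessel_J 1 (2 * pi * ?R n m)))
      = A * B * (bessel_J 1 (2 * pi * ?R n m) / ?R n m)" for n m
  proof -
    have "2 * a / (pi * k) * (pi / 2 * (2 * pi * k * b / (2 * pi * r) * j)) = a * b * (j / r)"
      if "k > 0" for a b k r j :: real
      using that by (cases "r = 0") (simp_all add: field_simps)
    then show ?thesis by simp
  qed
  moreover have "A * B * (pi / 2 * fact (2 * 1) / (4 ^ 1 * (fact 1)\<^sup>2)) = pi * A * B / 4"
    by (simp add: fact_numeral)
  ultimately show ?thesis
    by (simp only: sum_distrib_left)
qed

lemma abs_dirichlet_int_le: "\<bar>dirichlet_int K t\<bar> \<le> \<bar>t\<bar> + 2"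
proof -
  have "\<bar>mid_floor t\<bar> \<le> \<bar>t\<bar> + 1 / 2"
    unfolding mid_floor_def by (auto simp: abs_if) linarith+
  then show ?thesis using dirichlet_int_diff_mid_floor_le[of K t] by linarith
qed

text \<open>The arc integral only controls a combination of three sums, so the axis sums need their
  own convergence proof. Integration by parts trades the kernel for its primitive, which is bounded,
  and dominated convergence finishes.\<close>

lemma summable_bessel_J_1_over_Suc:
  assumes A: "A > 0"
  shows "summable (\<lambda>m. bessel_J 1 (2 * pi * real (Suc m) * A) / real (Suc m))"
proof -
  have eq: "(\<Sum>m<K. bessel_J 1 (2 * pi * real (Suc m) * A) / real (Suc m))
      = 2 * integral {0..pi/2} (\<lambda>\<theta>. dirichlet_int K (A * sin \<theta>) * sin \<theta>) - A * pi / 2" for K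
  proof -
    let ?a = "\<lambda>m. 2 * pi * real (Suc m) * A"
    have "((\<lambda>\<theta>. A * cos \<theta> ^ (2 * 1) + (\<Sum>m<K. 2 * A * ((cos \<theta>)\<^sup>2 * cos (?a m * sin \<theta>)))) has_integral
        A * (pi / 2 * fact (2 * 1) / (4 ^ 1 * (fact 1)\<^sup>2)) + (\<Sum>m<K. 2 * A * (pi / 2 * (bessel_J 1 (?a m) / ?a m)))) {0..pi/2}"
      by (intro has_integral_add has_integral_sum has_integral_mult_right finite_lessThan
        has_integral_cos_power_even bessel_J_1_has_integral_cos2) (use A in auto)
    moreover have "A * cos \<theta> ^ (2 * 1) + (\<Sum>m<K. 2 * A * ((cos \<theta>)\<^sup>2 * cos (?a m * sin \<theta>)))
        = dirichlet_arc A K \<theta> * cos \<theta>" for \<theta>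
      by (simp add: dirichlet_arc_def dirichlet_def sum_distrib_left algebra_simps power2_eq_square)
    moreover have "2 * A * (pi / 2 * (bessel_J 1 (?a m) / ?a m)) = 1 / 2 * (bessel_J 1 (?a m) / real (Suc m))" for m
    proof -
      have "2 * A * (pi / 2 * (j / (2 * pi * k * A))) = 1 / 2 * (j / k)" if "k > 0" for j k
        using that A by (simp add: field_simps)
      then show ?thesis by simp
    qed
    moreover have "A * (pi / 2 * fact (2 * 1) / (4 ^ 1 * (fact 1)\<^sup>2)) = A * pi / 4"
      by (simp add: fact_numeral)
    ultimately have 1: "((\<lambda>\<theta>. dirichlet_arc A K \<theta> * cos \<theta>) has_integral
        A * pi / 4 + 1 / 2 * (\<Sum>m<K. bessel_J 1 (?a m) / real (Suc m))) {0..pi/2}"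
      by (simp only: sum_distrib_left)
    have "((\<lambda>\<theta>. dirichlet_arc A K \<theta> * cos \<theta> - dirichlet_int K (A * sin \<theta>) * sin \<theta>) has_integral
        dirichlet_int K (A * sin (pi/2)) * cos (pi/2) - dirichlet_int K (A * sin 0) * cos 0) {0..pi/2}"
      by (rule fundamental_theorem_of_calculus)
         (auto simp: dirichlet_arc_def simp flip: has_real_derivative_iff_has_vector_derivative
           intro!: derivative_eq_intros)
    from has_integral_diff[OF 1 this] have "integral {0..pi/2} (\<lambda>\<theta>. dirichlet_int K (A * sin \<theta>) * sin \<theta>)
        = A * pi / 4 + 1 / 2 * (\<Sum>m<K. bessel_J 1 (?a m) / real (Suc m))"
      by (simp add: integral_unique)
    then show ?thesis by (simp add: field_simps)
  qed
  have "(\<lambda>K. integral {0..pi/2} (\<lambda>\<theta>. dirichlet_int K (A * sin \<theta>) * sin \<theta>))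
      \<longlonglongrightarrow> integral {0..pi/2} (\<lambda>\<theta>. mid_floor (A * sin \<theta>) * sin \<theta>)"
  proof (rule dominated_convergence(2)[where h = "\<lambda>_. A + 2"])
    fix \<theta> :: real and K
    have "\<bar>A * sin \<theta>\<bar> \<le> A" using A by (simp add: abs_mult)
    then have "\<bar>dirichlet_int K (A * sin \<theta>)\<bar> \<le> A + 2"
      using abs_dirichlet_int_le[of K "A * sin \<theta>"] by linarith
    then have "\<bar>dirichlet_int K (A * sin \<theta>)\<bar> * \<bar>sin \<theta>\<bar> \<le> (A + 2) * 1"
      using A by (intro mult_mono) auto
    then show "norm (dirichlet_int K (A * sin \<theta>) * sin \<theta>) \<le> A + 2"
      by (simp add: abs_mult)
  qed (auto intro!: integrable_continuous_real continuous_intros tendsto_mult dirichlet_int_tendsto)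
  then have "(\<lambda>K. \<Sum>m<K. bessel_J 1 (2 * pi * real (Suc m) * A) / real (Suc m)) \<longlonglongrightarrow>
      2 * integral {0..pi/2} (\<lambda>\<theta>. mid_floor (A * sin \<theta>) * sin \<theta>) - A * pi / 2"
    unfolding eq by (intro tendsto_intros)
  then show ?thesis by (auto simp: summable_def sums_def)
qed

subsection \<open>Counting lattice points\<close>

text \<open>Identifies the linear and sawtooth terms of the final formula with half of a staircase
  value.\<close>

lemma half_minus_B1_star_frac: "t / 2 - B1_star (frac t) / 2 = mid_floor t / 2"
  unfolding B1_star_frac mid_floor_def by (simp add: frac_def field_simps)

text \<open>For \<open>t \<ge> 0\<close> the left side counts the naturals up to \<open>t\<close>;
  the extra 1/2 at integers is the source of the characteristic function term.\<close>

lemma floor_Suc_eq_mid_floor: "of_int \<lfloor>t\<rfloor> + 1 = mid_floor t + 1 / 2 + (if t \<in> \<int> then 1 / 2 else 0)"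
  by (auto simp: mid_floor_def elim!: Ints_cases)

lemma ellipse_le_iff:
  assumes AB: "A > 0" "B > 0" and "0 \<le> u" "0 \<le> v"
  shows "(u / A)\<^sup>2 + (v / B)\<^sup>2 \<le> 1 \<longleftrightarrow> v \<le> B \<and> u \<le> A * sqrt (1 - (v / B)\<^sup>2)"
proof -
  have "v \<le> B" if "(u / A)\<^sup>2 + (v / B)\<^sup>2 \<le> 1"
  proof -
    have "(v / B)\<^sup>2 \<le> 1" using that zero_le_power2[of "u / A"] by linarith
    then have "v / B \<le> 1" using assms by (simp add: abs_square_le_1)
    then show ?thesis using AB by simp
  qed
  moreover have "(u / A)\<^sup>2 + (v / B)\<^sup>2 \<le> 1 \<longleftrightarrow> u \<le> A * sqrt (1 - (v / B)\<^sup>2)" if "v \<le> B"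
  proof -
    have "(u / A)\<^sup>2 + (v / B)\<^sup>2 \<le> 1 \<longleftrightarrow> (u / A)\<^sup>2 \<le> 1 - (v / B)\<^sup>2" by linarith
    also have "\<dots> \<longleftrightarrow> sqrt ((u / A)\<^sup>2) \<le> sqrt (1 - (v / B)\<^sup>2)"
      by (rule real_sqrt_le_iff[symmetric])
    also have "\<dots> \<longleftrightarrow> u / A \<le> sqrt (1 - (v / B)\<^sup>2)"
      using assms by simp
    also have "\<dots> \<longleftrightarrow> u \<le> A * sqrt (1 - (v / B)\<^sup>2)"
      using AB by (simp add: field_simps)
    finally show ?thesis .
  qed
  ultimately show ?thesis by blast
qed

lemma ellipse_eq_iff:
  assumes AB: "A > 0" "B > 0" and "0 \<le> u" "0 \<le> v"
  shows "(u / A)\<^sup>2 + (v / B)\<^sup>2 = 1 \<longleftrightarrow> v \<le> B \<and> u = A * sqrt (1 - (v / B)\<^sup>2)"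
proof
  assume eq: "(u / A)\<^sup>2 + (v / B)\<^sup>2 = 1"
  then have "1 - (v / B)\<^sup>2 = (u / A)\<^sup>2" by linarith
  then have "u = A * sqrt (1 - (v / B)\<^sup>2)" using assms by simp
  then show "v \<le> B \<and> u = A * sqrt (1 - (v / B)\<^sup>2)"
    using eq ellipse_le_iff[OF assms] by simp
next
  assume r: "v \<le> B \<and> u = A * sqrt (1 - (v / B)\<^sup>2)"
  then have "v / B \<le> 1" "0 \<le> v / B" using assms by auto
  then have "0 \<le> 1 - (v / B)\<^sup>2" by (simp add: abs_square_le_1)
  moreover have "u / A = sqrt (1 - (v / B)\<^sup>2)" using r AB by (simp add: field_simps)
  ultimately show "(u / A)\<^sup>2 + (v / B)\<^sup>2 = 1" by simp
qed

lemma card_ellipse: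
  assumes AB: "A > 0" "B > 0"
  shows "real (card {(p :: nat, q :: nat). (p / A)\<^sup>2 + (q / B)\<^sup>2 \<le> 1})
    = (\<Sum>q = 0..nat \<lfloor>B\<rfloor>. of_int \<lfloor>A * sqrt (1 - (q / B)\<^sup>2)\<rfloor> + 1)"
proof -
  define h where "h q = A * sqrt (1 - (real q / B)\<^sup>2)" for q
  have h: "h q \<ge> 0" if "q \<le> nat \<lfloor>B\<rfloor>" for q
  proof -
    have "real q \<le> B" by (intro order.trans[OF of_nat_mono[OF that] of_nat_floor]) (use AB in auto)
    then have "real q / B \<le> 1" "0 \<le> real q / B" using AB by auto
    then have "0 \<le> 1 - (real q / B)\<^sup>2" by (simp add: abs_square_le_1)
    then show ?thesis using AB by (simp add: h_def)
  qed
  have "{(p :: nat, q :: nat). (p / A)\<^sup>2 + (q / B)\<^sup>2 \<le> 1}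
      = prod.swap ` (SIGMA q:{0..nat \<lfloor>B\<rfloor>}. {0..nat \<lfloor>h q\<rfloor>})"
  proof -
    have "(p / A)\<^sup>2 + (q / B)\<^sup>2 \<le> 1 \<longleftrightarrow> q \<le> nat \<lfloor>B\<rfloor> \<and> p \<le> nat \<lfloor>h q\<rfloor>" for p q :: nat
      using ellipse_le_iff[OF AB, of p q] AB h[of q]
      by (auto simp: h_def le_nat_floor le_nat_iff le_floor_iff)
    then show ?thesis by (auto simp: image_iff)
  qed
  then have "card {(p :: nat, q :: nat). (p / A)\<^sup>2 + (q / B)\<^sup>2 \<le> 1}
      = card (SIGMA q:{0..nat \<lfloor>B\<rfloor>}. {0..nat \<lfloor>h q\<rfloor>})"
    by (simp add: card_image)
  also have "\<dots> = (\<Sum>q = 0..nat \<lfloor>B\<rfloor>. nat \<lfloor>h q\<rfloor> + 1)"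
    by (subst card_SigmaI) auto
  finally have "real (card {(p :: nat, q :: nat). (p / A)\<^sup>2 + (q / B)\<^sup>2 \<le> 1})
      = (\<Sum>q = 0..nat \<lfloor>B\<rfloor>. real (nat \<lfloor>h q\<rfloor>) + 1)"
    by (simp only: of_nat_sum of_nat_add of_nat_1)
  also have "\<dots> = (\<Sum>q = 0..nat \<lfloor>B\<rfloor>. of_int \<lfloor>h q\<rfloor> + 1)"
    using h by (intro sum.cong) auto
  finally show ?thesis unfolding h_def .
qed

text \<open>The points are counted by rows. Row 0 gives \<open>mid_floor A\<close>, split into two
  halves; the 1/2 from each of the \<open>\<lfloor>B\<rfloor> + 1\<close> rows adds up to
  \<open>mid_floor B / 2 + 1/4\<close> because \<open>B\<close> is not an integer; uniqueness leaves
  at most one integrality correction.\<close>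

lemma ellipse_count_mid_floor:
  assumes AB: "A > 0" "B > 0" and B: "B \<notin> \<int>"
    and unique: "\<And>(p::nat) (q::nat) (p'::nat) (q'::nat). (p / A)\<^sup>2 + (q / B)\<^sup>2 = 1 \<Longrightarrow> (p' / A)\<^sup>2 + (q' / B)\<^sup>2 = 1 \<Longrightarrow> p = p' \<and> q = q'"
  shows "real (card {(p :: nat, q :: nat). (p / A)\<^sup>2 + (q / B)\<^sup>2 \<le> 1})
    = (mid_floor A / 2 + (\<Sum>q = 1..nat \<lfloor>B\<rfloor>. mid_floor (A * sqrt (1 - (q / B)\<^sup>2))))
      + mid_floor A / 2 + mid_floor B / 2 + 1 / 4
      + (if \<exists>(p::nat) (q::nat). (p / A)\<^sup>2 + (q / B)\<^sup>2 = 1 then 1 / 2 else 0)"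
proof -
  define h where "h q = A * sqrt (1 - (real q / B)\<^sup>2)" for q
  have Ints: "h q \<in> \<int> \<longleftrightarrow> (\<exists>p::nat. (p / A)\<^sup>2 + (q / B)\<^sup>2 = 1)" if "q \<in> {0..nat \<lfloor>B\<rfloor>}" for q
  proof -
    have "real q \<le> B"
      using that by (intro order.trans[OF of_nat_mono of_nat_floor]) (use AB in auto)
    moreover from this have "real q / B \<le> 1" "0 \<le> real q / B" using AB by auto
    then have "0 \<le> 1 - (real q / B)\<^sup>2" by (simp add: abs_square_le_1)
    then have "h q \<ge> 0" using AB by (simp add: h_def)
    then have "h q \<in> \<int> \<longleftrightarrow> (\<exists>p::nat. real p = h q)"
      by (metis Ints_cases Ints_of_nat of_int_0_le_iff of_int_of_nat_eq zero_le_imp_eq_int)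
    ultimately show ?thesis
      using ellipse_eq_iff[OF AB] by (simp add: h_def)
  qed
  have chi: "(\<Sum>q = 0..nat \<lfloor>B\<rfloor>. if h q \<in> \<int> then 1 / 2 else 0)
      = (if \<exists>(p::nat) (q::nat). (p / A)\<^sup>2 + (q / B)\<^sup>2 = 1 then 1 / 2 else (0::real))"
  proof (cases "\<exists>(p::nat) (q::nat). (p / A)\<^sup>2 + (q / B)\<^sup>2 = 1")
    case True
    then obtain p0 q0 :: nat where pq: "(p0 / A)\<^sup>2 + (q0 / B)\<^sup>2 = 1" by blast
    then have "real q0 \<le> B" using ellipse_eq_iff[OF AB, of p0 q0] by simp
    then have q0: "q0 \<in> {0..nat \<lfloor>B\<rfloor>}" by (simp add: le_nat_floor)
    have "(\<Sum>q = 0..nat \<lfloor>B\<rfloor>. if h q \<in> \<int> then 1 / 2 else 0)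
        = (\<Sum>q = 0..nat \<lfloor>B\<rfloor>. if q = q0 then 1 / 2 else (0::real))"
      using Ints unique pq by (intro sum.cong refl) (auto; blast)
    then show ?thesis using True q0 by simp
  next
    case False
    then have "(\<Sum>q = 0..nat \<lfloor>B\<rfloor>. if h q \<in> \<int> then 1 / 2 else (0::real)) = 0"
      using Ints by (intro sum.neutral) auto
    then show ?thesis using False by simp
  qed
  have "mid_floor B = real (nat \<lfloor>B\<rfloor>) + 1 / 2"
    using B AB by (simp add: mid_floor_def)
  moreover have "(\<Sum>q = 0..nat \<lfloor>B\<rfloor>. mid_floor (h q)) = mid_floor A + (\<Sum>q = 1..nat \<lfloor>B\<rfloor>. mid_floor (h q))"
    by (simp add: sum.atLeast_Suc_atMost h_def)
  moreover have "real (card {(p :: nat, q :: nat). (p / A)\<^sup>2 + (q / B)\<^sup>2 \<le> 1})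
      = (\<Sum>q = 0..nat \<lfloor>B\<rfloor>. mid_floor (h q)) + (real (nat \<lfloor>B\<rfloor>) + 1) / 2
        + (\<Sum>q = 0..nat \<lfloor>B\<rfloor>. if h q \<in> \<int> then 1 / 2 else 0)"
    unfolding card_ellipse[OF AB] h_def[symmetric] floor_Suc_eq_mid_floor sum.distrib
    by (simp add: add.commute)
  ultimately have "real (card {(p :: nat, q :: nat). (p / A)\<^sup>2 + (q / B)\<^sup>2 \<le> 1})
      = (mid_floor A / 2 + (\<Sum>q = 1..nat \<lfloor>B\<rfloor>. mid_floor (h q))) + mid_floor A / 2 + mid_floor B / 2 + 1 / 4
        + (if \<exists>(p::nat) (q::nat). (p / A)\<^sup>2 + (q / B)\<^sup>2 = 1 then 1 / 2 else 0)"
    unfolding chi by (simp add: add_divide_distrib)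
  then show ?thesis unfolding h_def .
qed

section \<open>Assembly of the exact formula, first for ellipses and then for powers\<close>

lemma double_sums_transpose:
  assumes "f double_sums s"
  shows "(\<lambda>n m. f m n) double_sums s"
proof -
  have "(\<Sum>n<K. \<Sum>m<K. f m n) = (\<Sum>n<K. \<Sum>m<K. f n m)" for K
    by (rule sum.swap)
  then show ?thesis using assms by (simp add: double_sums_def)
qed

lemma bessel_ellipse_count_nonint:
  assumes AB: "A > 0" "B > 0" and B: "B \<notin> \<int>"
    and unique: "\<And>(p::nat) (q::nat) (p'::nat) (q'::nat). (p / A)\<^sup>2 + (q / B)\<^sup>2 = 1 \<Longrightarrow> (p' / A)\<^sup>2 + (q' / B)\<^sup>2 = 1 \<Longrightarrow> p = p' \<and> q = q'"
  obtains D E F where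
    "(\<lambda>n m. bessel_J 1 (2 * pi * sqrt ((real (Suc n) * B)\<^sup>2 + (real (Suc m) * A)\<^sup>2))
          / sqrt ((real (Suc n) * B)\<^sup>2 + (real (Suc m) * A)\<^sup>2)) double_sums D"
    "(\<lambda>k. bessel_J 1 (2 * pi * real (Suc k) * B) / real (Suc k)) sums E"
    "(\<lambda>k. bessel_J 1 (2 * pi * real (Suc k) * A) / real (Suc k)) sums F"
    "real (card {(p :: nat, q :: nat). (p / A)\<^sup>2 + (q / B)\<^sup>2 \<le> 1})
      = pi * A * B / 4 + A / 2 + B / 2 + 1 / 4 - B1_star (frac A) / 2 - B1_star (frac B) / 2
        + A * B * D + A / 2 * E + B / 2 * F
        + (if \<exists>(p::nat) (q::nat). (p / A)\<^sup>2 + (q / B)\<^sup>2 = 1 then 1 / 2 else 0)"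
proof -
  let ?f = "\<lambda>n m. bessel_J 1 (2 * pi * sqrt ((real (Suc n) * B)\<^sup>2 + (real (Suc m) * A)\<^sup>2))
          / sqrt ((real (Suc n) * B)\<^sup>2 + (real (Suc m) * A)\<^sup>2)"
  let ?e = "\<lambda>A k. bessel_J 1 (2 * pi * real (Suc k) * A) / real (Suc k)"
  define T where "T = mid_floor A / 2 + (\<Sum>q = 1..nat \<lfloor>B\<rfloor>. mid_floor (A * sqrt (1 - (q / B)\<^sup>2)))"
  define E where "E = suminf (?e B)"
  define F where "F = suminf (?e A)"
  \<comment> \<open>The value of the double series is obtained by solving for it: the arc integral
    and both axis sums converge, hence so do the square partial sums.\<close>
  define D where "D = (T - pi * A * B / 4 - B / 2 * F - A / 2 * E) / (A * B)"
  have E: "?e B sums E" and F: "?e A sums F"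
    unfolding E_def F_def by (intro summable_sums summable_bessel_J_1_over_Suc AB)+
  have "(\<lambda>K. (integral {0..pi/2} (\<lambda>\<theta>. dirichlet_arc A K \<theta> * dirichlet_int K (B * cos \<theta>))
      - pi * A * B / 4 - B / 2 * (\<Sum>m<K. ?e A m) - A / 2 * (\<Sum>n<K. ?e B n)) / (A * B)) \<longlonglongrightarrow> D"
    unfolding D_def T_def
    using E F AB unfolding sums_def
    by (intro tendsto_intros dirichlet_quarter_ellipse_tendsto[OF AB B unique]) auto
  then have D: "?f double_sums D"
    unfolding double_sums_def integral_unique[OF dirichlet_quarter_ellipse_has_integral[OF AB]]
    using AB by simp
  have "T = pi * A * B / 4 + A * B * D + A / 2 * E + B / 2 * F"
    using AB by (simp add: D_def)
  then show ?thesis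
    using ellipse_count_mid_floor[OF AB B unique] half_minus_B1_star_frac[of A] half_minus_B1_star_frac[of B]
    unfolding T_def[symmetric] by (intro that[OF D E F]) linarith
qed

lemma bessel_ellipse_count:
  assumes AB: "A > 0" "B > 0"
    and unique: "\<And>(p::nat) (q::nat) (p'::nat) (q'::nat). (p / A)\<^sup>2 + (q / B)\<^sup>2 = 1 \<Longrightarrow> (p' / A)\<^sup>2 + (q' / B)\<^sup>2 = 1 \<Longrightarrow> p = p' \<and> q = q'"
  obtains D E F where
    "(\<lambda>n m. bessel_J 1 (2 * pi * sqrt ((real (Suc n) * B)\<^sup>2 + (real (Suc m) * A)\<^sup>2))
          / sqrt ((real (Suc n) * B)\<^sup>2 + (real (Suc m) * A)\<^sup>2)) double_sums D"
    "(\<lambda>k. bessel_J 1 (2 * pi * real (Suc k) * B) / real (Suc k)) sums E"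
    "(\<lambda>k. bessel_J 1 (2 * pi * real (Suc k) * A) / real (Suc k)) sums F"
    "real (card {(p :: nat, q :: nat). (p / A)\<^sup>2 + (q / B)\<^sup>2 \<le> 1})
      = pi * A * B / 4 + A / 2 + B / 2 + 1 / 4 - B1_star (frac A) / 2 - B1_star (frac B) / 2
        + A * B * D + A / 2 * E + B / 2 * F
        + (if \<exists>(p::nat) (q::nat). (p / A)\<^sup>2 + (q / B)\<^sup>2 = 1 then 1 / 2 else 0)"
proof (cases "B \<in> \<int>")
  case False
  show ?thesis by (rule bessel_ellipse_count_nonint[OF AB False unique that])
next
  case True
  have "A \<notin> \<int>"
  proof
    assume "A \<in> \<int>"
    then obtain p q :: nat where "A = real p" "B = real q"
      using True AB by (metis Ints_cases less_imp_le of_int_0_le_iff of_int_of_nat_eq zero_le_imp_eq_int)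
    \<comment> \<open>Two integer semi-axes would put both vertices \<open>(A, 0)\<close> and
      \<open>(0, B)\<close> on the arc.\<close>
    then show False using unique[of p 0 0 q] AB by simp
  qed
  have unique': "p = p' \<and> q = q'" if "(p / B)\<^sup>2 + (q / A)\<^sup>2 = 1" "(p' / B)\<^sup>2 + (q' / A)\<^sup>2 = 1" for p q p' q' :: nat
    using unique[of q p q' p'] that by (simp add: add.commute)
  obtain D E F where
    D: "(\<lambda>n m. bessel_J 1 (2 * pi * sqrt ((real (Suc n) * A)\<^sup>2 + (real (Suc m) * B)\<^sup>2))
          / sqrt ((real (Suc n) * A)\<^sup>2 + (real (Suc m) * B)\<^sup>2)) double_sums D"
    and EF: "(\<lambda>k. bessel_J 1 (2 * pi * real (Suc k) * A) / real (Suc k)) sums E"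
    "(\<lambda>k. bessel_J 1 (2 * pi * real (Suc k) * B) / real (Suc k)) sums F"
    and card: "real (card {(p :: nat, q :: nat). (p / B)\<^sup>2 + (q / A)\<^sup>2 \<le> 1})
      = pi * B * A / 4 + B / 2 + A / 2 + 1 / 4 - B1_star (frac B) / 2 - B1_star (frac A) / 2
        + B * A * D + B / 2 * E + A / 2 * F
        + (if \<exists>(p::nat) (q::nat). (p / B)\<^sup>2 + (q / A)\<^sup>2 = 1 then 1 / 2 else 0)"
    by (rule bessel_ellipse_count_nonint[OF AB(2,1) \<open>A \<notin> \<int>\<close> unique'])
  have "{(p :: nat, q :: nat). (p / A)\<^sup>2 + (q / B)\<^sup>2 \<le> 1} = prod.swap ` {(p :: nat, q :: nat). (p / B)\<^sup>2 + (q / A)\<^sup>2 \<le> 1}"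
    by (auto simp: image_iff add.commute)
  then have "card {(p :: nat, q :: nat). (p / A)\<^sup>2 + (q / B)\<^sup>2 \<le> 1} = card {(p :: nat, q :: nat). (p / B)\<^sup>2 + (q / A)\<^sup>2 \<le> 1}"
    by (simp add: card_image)
  moreover have "(\<exists>(p::nat) (q::nat). (p / A)\<^sup>2 + (q / B)\<^sup>2 = 1) \<longleftrightarrow> (\<exists>(p::nat) (q::nat). (p / B)\<^sup>2 + (q / A)\<^sup>2 = 1)"
  proof -
    have "(real p / A)\<^sup>2 + (real q / B)\<^sup>2 = 1 \<longleftrightarrow> (real q / B)\<^sup>2 + (real p / A)\<^sup>2 = 1" for p q
      by (subst add.commute) (rule refl)
    then show ?thesis by blast
  qed
  moreover have "(\<lambda>n m. bessel_J 1 (2 * pi * sqrt ((real (Suc n) * B)\<^sup>2 + (real (Suc m) * A)\<^sup>2))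
          / sqrt ((real (Suc n) * B)\<^sup>2 + (real (Suc m) * A)\<^sup>2)) double_sums D"
    using double_sums_transpose[OF D] by (simp only: add.commute)
  ultimately show ?thesis
    using card by (intro that[OF _ EF(2,1), of D]) (simp_all add: mult.commute[of B A] mult.assoc)
qed

text \<open>Cancelling the smaller power of \<open>a\<close> leaves a power of \<open>a\<close> that
  divides a power of \<open>b\<close>; being coprime to it, it is 1.\<close>

lemma coprime_power_mult_inject:
  fixes a b :: nat
  assumes ab: "a \<ge> 2" "b \<ge> 2" "coprime a b" and eq: "a ^ i * b ^ j = a ^ k * b ^ l"
  shows "i = k \<and> j = l"
proof -
  have *: "i = k" if "i \<le> k" "a ^ i * b ^ j = a ^ k * b ^ l" for i j k l
  proof -
    have "a ^ i * b ^ j = a ^ i * (a ^ (k - i) * b ^ l)"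
      using that by (simp add: mult.assoc[symmetric] flip: power_add)
    then have "b ^ j = a ^ (k - i) * b ^ l" using ab by simp
    then have "a ^ (k - i) dvd b ^ j" by simp
    moreover have "coprime (a ^ (k - i)) (b ^ j)" using ab by simp
    ultimately have "a ^ (k - i) = 1" by (metis coprime_absorb_left nat_dvd_1_iff_1)
    then show "i = k" using ab that by simp
  qed
  have "i = k" using *[of i k j l] *[of k i l j] eq by (cases "i \<le> k") auto
  then show ?thesis using eq ab by simp
qed

theorem theorem17:
  fixes a b :: nat and x :: real
  assumes "2 \<le> a" and "a < b" and "gcd a b = 1" and "x > 1"
  shows "\<exists>D E F.
    (\<lambda>n m. bessel_J 1 (2 * pi * sqrt (((real (Suc n))\<^sup>2 * ln (real a) + (real (Suc m))\<^sup>2 * ln (real b))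
                                     / (ln (real a) * ln (real b)) * ln x))
           / sqrt ((real (Suc n))\<^sup>2 * ln (real a) + (real (Suc m))\<^sup>2 * ln (real b))) double_sums D \<and>
    (\<lambda>k. bessel_J 1 (2 * pi * real (Suc k) * sqrt (ln x / ln (real b))) / real (Suc k)) sums E \<and>
    (\<lambda>k. bessel_J 1 (2 * pi * real (Suc k) * sqrt (ln x / ln (real a))) / real (Suc k)) sums F \<and>
    real (N2 a b x) =
      pi * ln x / (4 * sqrt (ln (real a) * ln (real b)))
      + 1 / 2 * sqrt (ln x / ln (real a)) + 1 / 2 * sqrt (ln x / ln (real b)) + 1 / 4
      - 1 / 2 * B1_star (frac (sqrt (ln x / ln (real a))))
      - 1 / 2 * B1_star (frac (sqrt (ln x / ln (real b))))
      + sqrt (ln x) * D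
      + 1 / 2 * sqrt (ln x / ln (real a)) * E
      + 1 / 2 * sqrt (ln x / ln (real b)) * F
      + 1 / 2 * indicator (S2 a b) x"
proof -
  define X where "X = ln x"
  define \<alpha> where "\<alpha> = ln (real a)"
  define \<beta> where "\<beta> = ln (real b)"
  \<comment> \<open>Taking logarithms turns \<open>a ^ (p\<^sup>2) * b ^ (q\<^sup>2) \<le> x\<close>
    into membership in the ellipse with semi-axes \<open>A\<close> and \<open>B\<close>.\<close>
  define A where "A = sqrt (X / \<alpha>)"
  define B where "B = sqrt (X / \<beta>)"
  have pos: "X > 0" "\<alpha> > 0" "\<beta> > 0" using assms by (auto simp: X_def \<alpha>_def \<beta>_def)
  then have AB: "A > 0" "B > 0" by (auto simp: A_def B_def)
  have ln_eq: "ln (real (a ^ (p\<^sup>2) * b ^ (q\<^sup>2))) = X * ((p / A)\<^sup>2 + (q / B)\<^sup>2)" for p q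
  proof -
    have "ln (real (a ^ (p\<^sup>2) * b ^ (q\<^sup>2))) = (real p)\<^sup>2 * \<alpha> + (real q)\<^sup>2 * \<beta>"
      using assms by (simp add: ln_mult ln_realpow \<alpha>_def \<beta>_def)
    also have "\<dots> = X * ((p / A)\<^sup>2 + (q / B)\<^sup>2)"
      using pos by (simp add: A_def B_def power_divide field_simps)
    finally show ?thesis .
  qed
  have gt0: "real (a ^ (p\<^sup>2) * b ^ (q\<^sup>2)) > 0" for p q using assms by simp
  have le: "real (a ^ (p\<^sup>2) * b ^ (q\<^sup>2)) \<le> x \<longleftrightarrow> (p / A)\<^sup>2 + (q / B)\<^sup>2 \<le> 1" for p q
  proof -
    have "real (a ^ (p\<^sup>2) * b ^ (q\<^sup>2)) \<le> x \<longleftrightarrow> X * ((p / A)\<^sup>2 + (q / B)\<^sup>2) \<le> X * 1"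
      unfolding ln_eq[symmetric] using ln_le_cancel_iff[OF gt0, of x] assms by (simp add: X_def)
    then show ?thesis using pos by (simp only: mult_le_cancel_left_pos)
  qed
  have eq: "real (a ^ (p\<^sup>2) * b ^ (q\<^sup>2)) = x \<longleftrightarrow> (p / A)\<^sup>2 + (q / B)\<^sup>2 = 1" for p q
  proof -
    have "real (a ^ (p\<^sup>2) * b ^ (q\<^sup>2)) = x \<longleftrightarrow> X * ((p / A)\<^sup>2 + (q / B)\<^sup>2) = X * 1"
      unfolding ln_eq[symmetric] using ln_inj_iff[OF gt0, of x] assms by (simp add: X_def)
    then show ?thesis using pos by simp
  qed
  have unique: "p = p' \<and> q = q'" if "(p / A)\<^sup>2 + (q / B)\<^sup>2 = 1" "(p' / A)\<^sup>2 + (q' / B)\<^sup>2 = 1" for p q p' q' :: nat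
  proof -
    have "real (a ^ (p\<^sup>2) * b ^ (q\<^sup>2)) = real (a ^ (p'\<^sup>2) * b ^ (q'\<^sup>2))"
      using eq[of p q] eq[of p' q'] that by metis
    then have "a ^ (p\<^sup>2) * b ^ (q\<^sup>2) = a ^ (p'\<^sup>2) * b ^ (q'\<^sup>2)" by (simp only: of_nat_eq_iff)
    from coprime_power_mult_inject[OF _ _ _ this] have "p\<^sup>2 = p'\<^sup>2" "q\<^sup>2 = q'\<^sup>2"
      using assms by (auto simp: coprime_iff_gcd_eq_1)
    then show ?thesis by simp
  qed
  obtain D E F where
    D: "(\<lambda>n m. bessel_J 1 (2 * pi * sqrt ((real (Suc n) * B)\<^sup>2 + (real (Suc m) * A)\<^sup>2))
          / sqrt ((real (Suc n) * B)\<^sup>2 + (real (Suc m) * A)\<^sup>2)) double_sums D"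
    and EF: "(\<lambda>k. bessel_J 1 (2 * pi * real (Suc k) * B) / real (Suc k)) sums E"
    "(\<lambda>k. bessel_J 1 (2 * pi * real (Suc k) * A) / real (Suc k)) sums F"
    and card: "real (card {(p :: nat, q :: nat). (p / A)\<^sup>2 + (q / B)\<^sup>2 \<le> 1})
      = pi * A * B / 4 + A / 2 + B / 2 + 1 / 4 - B1_star (frac A) / 2 - B1_star (frac B) / 2
        + A * B * D + A / 2 * E + B / 2 * F
        + (if \<exists>(p::nat) (q::nat). (p / A)\<^sup>2 + (q / B)\<^sup>2 = 1 then 1 / 2 else 0)"
    by (rule bessel_ellipse_count[OF AB unique])
  have AB_eq: "A * B = X / sqrt (\<alpha> * \<beta>)"
    using pos by (simp add: A_def B_def real_sqrt_mult[symmetric] real_sqrt_divide)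
  \<comment> \<open>The index paired with \<open>B\<close> picks up \<open>\<alpha>\<close>, and
    conversely, because \<open>B\<^sup>2 = X / \<beta> = X * \<alpha> / (\<alpha> *
    \<beta>)\<close>.\<close>
  have R: "sqrt ((u * B)\<^sup>2 + (v * A)\<^sup>2) = sqrt ((u\<^sup>2 * \<alpha> + v\<^sup>2 * \<beta>) / (\<alpha> * \<beta>) * X)" for u v
    using pos by (simp add: A_def B_def power_mult_distrib field_simps)
  have R': "A * B / sqrt ((u\<^sup>2 * \<alpha> + v\<^sup>2 * \<beta>) / (\<alpha> * \<beta>) * X) = sqrt X / sqrt (u\<^sup>2 * \<alpha> + v\<^sup>2 * \<beta>)" for u v
  proof -
    have "X = sqrt X * sqrt X" using pos by simp
    then show ?thesis
      using pos by (simp add: AB_eq real_sqrt_mult real_sqrt_divide divide_simps)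
  qed
  \<comment> \<open>The terms of the statement are those of the ellipse series rescaled by the
    constant \<open>A * B / sqrt X\<close>; the factor \<open>sqrt (ln x)\<close> in the formula
    then restores \<open>A * B * D\<close>.\<close>
  have D': "(\<lambda>n m. bessel_J 1 (2 * pi * sqrt (((real (Suc n))\<^sup>2 * \<alpha> + (real (Suc m))\<^sup>2 * \<beta>) / (\<alpha> * \<beta>) * X))
           / sqrt ((real (Suc n))\<^sup>2 * \<alpha> + (real (Suc m))\<^sup>2 * \<beta>)) double_sums (A * B / sqrt X * D)"
  proof -
    have term_eq: "j / sqrt (u\<^sup>2 * \<alpha> + v\<^sup>2 * \<beta>)
        = A * B / sqrt X * (j / sqrt ((u\<^sup>2 * \<alpha> + v\<^sup>2 * \<beta>) / (\<alpha> * \<beta>) * X))" for j u v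
    proof -
      have "A * B / sqrt X * (j / sqrt ((u\<^sup>2 * \<alpha> + v\<^sup>2 * \<beta>) / (\<alpha> * \<beta>) * X))
          = A * B / sqrt ((u\<^sup>2 * \<alpha> + v\<^sup>2 * \<beta>) / (\<alpha> * \<beta>) * X) * j / sqrt X" by simp
      also have "\<dots> = j / sqrt (u\<^sup>2 * \<alpha> + v\<^sup>2 * \<beta>)" unfolding R' using pos by simp
      finally show ?thesis ..
    qed
    show ?thesis
      using D unfolding R double_sums_def term_eq sum_distrib_left[symmetric]
      by (rule tendsto_mult_left)
  qed
  have "N2 a b x = card {(p :: nat, q :: nat). (p / A)\<^sup>2 + (q / B)\<^sup>2 \<le> 1}"
    unfolding N2_def le ..
  moreover have "1 / 2 * indicator (S2 a b) x = (if \<exists>(p::nat) (q::nat). (p / A)\<^sup>2 + (q / B)\<^sup>2 = 1 then 1 / 2 else (0::real))"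
    unfolding S2_def indicator_def eq[symmetric] by auto
  moreover have "pi * X / (4 * sqrt (\<alpha> * \<beta>)) = pi * A * B / 4"
    using AB_eq by (simp add: mult.assoc)
  moreover have "sqrt X * (A * B / sqrt X * D) = A * B * D" using pos by simp
  ultimately have "real (N2 a b x) = pi * X / (4 * sqrt (\<alpha> * \<beta>)) + 1 / 2 * A + 1 / 2 * B + 1 / 4
      - 1 / 2 * B1_star (frac A) - 1 / 2 * B1_star (frac B) + sqrt X * (A * B / sqrt X * D)
      + 1 / 2 * A * E + 1 / 2 * B * F + 1 / 2 * indicator (S2 a b) x"
    using card by simp
  then show ?thesis
    using D' EF unfolding A_def B_def X_def \<alpha>_def \<beta>_def by blast
qed

end
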